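(* Let $t\le T-1$, let $\xi\in L^0(\mathbb R^d,\mathcal F_T)$ be hedgeable, and suppose that Condition AEP holds. Suppose that one of the following holds: (i) there is a lower semicontinuous function $\tilde\gamma_{t+1}^{\xi}$ on $\mathbb R^m\times\mathbb R^d$ with $\gamma_{t+1}^\xi(V_t)=\tilde\gamma_{t+1}^\xi(S_{t+1},V_t)$ for all $V_t\in L^0(\mathbb R^d,\mathcal F_t)$, and for each $u\le T-1$ there are Borel functions $\alpha_u^k:\mathbb R^m\to\mathbb R^m$, $k\ge1$, such that $\operatorname{supp}_{\mathcal F_u}S_{u+1}=\operatorname{cl}\{\alpha_u^k(S_u):k\ge1\}$; or (ii) there is a Borel function $\tilde\gamma_{t+1}^{\xi}$ on $\mathbb R^m\times\mathbb R^d$ with $\gamma_{t+1}^\xi(V_t)=\tilde\gamma_{t+1}^\xi(S_{t+1},V_t)$ for all $V_t\in L^0(\mathbb R^d,\mathcal F_t)$, and for each $u\le T-1$ there are Borel functions $\alpha_u^k:\mathbb R^m\to\mathbb R^m$, $k\ge1$, such that $S_{u+1}\in\{\alpha_u^k(S_u):k\ge1\}$ a.s. and $P(S_{u+1}=\alpha_u^k(S_u)\mid\mathcal F_u)>0$ a.s. for all $k\ge1$. Suppose moreover that $\tilde\gamma_{t+1}^{\xi}(s,v)$ is convex in $v$. Then $\gamma_t^{\xi}(V_{t-1})=\tilde\gamma_t^{\xi}(S_t,V_{t-1})$, where $\tilde\gamma_t^{\xi}(s,v)$ is an $\mathcal F_t$-normal integrand, convex in $v$. Moreover, with $\alpha_k:=\alpha_t^k$,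 $$\tilde\gamma_t^{\xi}(s,v)=\inf_{y\in\mathbb R^d}\Big(C_t\big(s,(0,y^{(2)}-v^{(2)})\big)+\sup_{k\ge1}\tilde\gamma_{t+1}^{\xi}(\alpha_k(s),y)\Big).$$
   Context: Setting. $(\Omega,(\mathcal F_t)_{t=0}^T,P)$ is a discrete-time stochastic basis with complete filtration ($\mathcal F_0$ contains the $P$-null sets); $\mathcal F_{-1}:=\mathcal F_0$. For a (random) set $A\subseteq\mathbb R^k$, $L^0(A,\mathcal F_t)$ is the set of (classes of) $\mathcal F_t$-measurable random variables $X$ with $X\in A$ a.s. Equalities between random variables are a.s. For $z\in\mathbb R^d$ write $z=(z^1,z^{(2)})$ with $z^{(2)}=(z^2,\dots,z^d)$, and $e_1=(1,0,\dots,0)$. For a family of random variables, $\operatorname{ess\,sup}_{\mathcal F_t}$ (resp. $\operatorname{ess\,inf}_{\mathcal F_t}$) is the smallest (resp. largest) $\mathcal F_t$-measurable $[-\infty,\infty]$-valued random variable which a.s. dominates (resp. is a.s. dominated by) every member; for a single random variable $X$ it is that of $\{X\}$. An $\mathcal F$-normal integrand is an (extended real-valued) function $f(\omega,x)$ on $\Omega\times\mathbb R^k$ that is $\mathcal F\otimes\mathcal B(\mathbb R^k)$-measurable and lower semicontinuous in $x$. $\operatorname{supp}_{\mathcal F_t}S_{t+1}$ (conditional support) is the smallest $\mathcal F_t$-measurable random closed set containing $S_{t+1}$ a.s.; $\operatorname{cl}$ denotes closure. Market. $S_t$ is an $\mathcal F_t$-measurable $\mathbb R^m_+$-valued random variable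 ($m\ge d\ge 1$). For $t\le T$ the cost function $C_t:\mathbb R^m\times\mathbb R^d\to\mathbb R$ is Borel and lower semicontinuous and satisfies: $C_t(s,0)=0$ for $s\in\mathbb R^m_+$; $C_t(s,x+\lambda e_1)=C_t(s,x)+\lambda$ for $\lambda\in\mathbb R$; $C_T(s,x_2)\ge C_T(s,x_1)$ whenever $x_2-x_1\in\mathbb R^d_+$; $|C_t(s,x)|\le h_t(s,x)$ for a deterministic continuous function $h_t$. One writes $C_t(x)=C_t(S_t,x)$, and $C_t(0,x^{(2)})$ means $C_t(S_t,(0,x^{(2)}))$. The solvency sets are $G_t=\{z\in\mathbb R^d: -C_t(-z)\ge 0\}$; they are closed, graph-measurable w.r.t. $\mathcal F_t$, satisfy $G_t+\mathbb R^d_+\subseteq G_t$, $-e_1\notin G_t$, and $C_t(z)=\min\{\alpha\in\mathbb R:\alpha e_1-z\in G_t\}$. A portfolio process is an adapted $\mathbb R^d$-valued process $V$ with $V_{-1}\in\mathbb R e_1$ and $V_t-V_{t-1}\in -G_t$ a.s. for $t=0,\dots,T$. The payoff $\xi$ is hedgeable if there is a portfolio process $V^\xi$ with $V_T^\xi=\xi$. Hedging costs. For $\xi\in L^0(\mathbb R^d,\mathcal F_T)$, $0\le t\le T$ and $V_{t-1}\in L^0(\mathbb R^d,\mathcal F_t)$, $$\gamma_t^{\xi}(V_{t-1}):=\operatorname*{ess\,inf}_{V^{(2)}\in\Pi_t^T(V_{t-1},\xi)}{}_{\mathcal F_t}\ \operatorname{ess\,sup}_{\mathcal F_t}\Big(\xi^1+\sum_{s=t}^T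 C_s\big(0,V_s^{(2)}-V_{s-1}^{(2)}\big)\Big),$$ where $\Pi_t^T(V_{t-1},\xi)$ is the set of families $(V_s^{(2)})_{s=t-1}^T$ whose entry at $t-1$ is the given $V_{t-1}^{(2)}$, with $V_s^{(2)}\in L^0(\mathbb R^{d-1},\mathcal F_s)$ for $s=t,\dots,T-1$ and $V_T^{(2)}=\xi^{(2)}$. Condition AEP (Absence of Early Profit): for every $t\le T$ and every $V_t\in L^0(\mathbb R^d,\mathcal F_t)$, $\gamma_t^0(V_t)>-\infty$ a.s. (superscript $0$: payoff $\xi=0$).
   Formalization: That γ̃_t is an F_t-normal integrand and convex in v is stated only when x ↦ C_t(s,x) is convex for all s; for non-convex C_t (e.g. a fixed cost) both can fail. γ_t(V_{t-1}) = γ̃_t(S_t,V_{t-1}) and the inf–sup formula hold without it. *)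

theory Defs
  imports "HOL-Probability.Probability"
begin

section \<open>Semicontinuity, convexity and normal integrands for extended real functions\<close>

definition lsc :: "('a::topological_space \<Rightarrow> 'b::linorder_topology) \<Rightarrow> bool"
  where "lsc f \<longleftrightarrow> (\<forall>a. closed {x. f x \<le> a})"

text \<open>Convexity of the epigraph: the values \<open>\<plusminus>\<infinity>\<close> are allowed, and no convention
  for \<open>\<infinity> - \<infinity>\<close> is involved.\<close>

definition ext_convex :: "('a::real_vector \<Rightarrow> ereal) \<Rightarrow> bool"
  where "ext_convex f \<longleftrightarrow> convex {(x, r::real). f x \<le> ereal r}"

definition normal_integrand ::
    "'a measure \<Rightarrow> ('a \<Rightarrow> 'b::topological_space \<Rightarrow> ereal) \<Rightarrow> bool"
  where "normal_integrand N f \<longleftrightarrow>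
    (\<lambda>(\<omega>, x). f \<omega> x) \<in> borel_measurable (N \<Otimes>\<^sub>M borel) \<and> (\<forall>\<omega>\<in>space N. lsc (f \<omega>))"


section \<open>Conditional essential bounds and conditional support\<close>

text \<open>Throughout, \<open>N\<close> is a sub-\<open>\<sigma>\<close>-algebra of the probability space \<open>M\<close>. Essential bounds of a
  family are determined only up to an \<open>M\<close>-null set; a version is picked by choice.\<close>

definition ess_upper_bound :: "'a measure \<Rightarrow> 'a measure \<Rightarrow> ('a \<Rightarrow> ereal) set \<Rightarrow> ('a \<Rightarrow> ereal) \<Rightarrow> bool"
  where "ess_upper_bound M N \<X> Z \<longleftrightarrow>
    Z \<in> borel_measurable N \<and> (\<forall>X\<in>\<X>. AE \<omega> in M. X \<omega> \<le> Z \<omega>)"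

definition ess_lower_bound :: "'a measure \<Rightarrow> 'a measure \<Rightarrow> ('a \<Rightarrow> ereal) set \<Rightarrow> ('a \<Rightarrow> ereal) \<Rightarrow> bool"
  where "ess_lower_bound M N \<X> Z \<longleftrightarrow>
    Z \<in> borel_measurable N \<and> (\<forall>X\<in>\<X>. AE \<omega> in M. Z \<omega> \<le> X \<omega>)"

definition cond_ess_sup :: "'a measure \<Rightarrow> 'a measure \<Rightarrow> ('a \<Rightarrow> ereal) set \<Rightarrow> 'a \<Rightarrow> ereal"
  where "cond_ess_sup M N \<X> = (SOME Z. ess_upper_bound M N \<X> Z \<and>
    (\<forall>Z'. ess_upper_bound M N \<X> Z' \<longrightarrow> (AE \<omega> in M. Z \<omega> \<le> Z' \<omega>)))"

definition cond_ess_inf :: "'a measure \<Rightarrow> 'a measure \<Rightarrow> ('a \<Rightarrow> ereal) set \<Rightarrow> 'a \<Rightarrow> ereal"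
  where "cond_ess_inf M N \<X> = (SOME Z. ess_lower_bound M N \<X> Z \<and>
    (\<forall>Z'. ess_lower_bound M N \<X> Z' \<longrightarrow> (AE \<omega> in M. Z' \<omega> \<le> Z \<omega>)))"

definition random_closed_set :: "'a measure \<Rightarrow> ('a \<Rightarrow> 'b::topological_space set) \<Rightarrow> bool"
  where "random_closed_set N \<Gamma> \<longleftrightarrow> (\<forall>\<omega>\<in>space N. closed (\<Gamma> \<omega>)) \<and>
    (\<forall>U. open U \<longrightarrow> {\<omega>\<in>space N. \<Gamma> \<omega> \<inter> U \<noteq> {}} \<in> sets N)"

text \<open>\<open>\<Gamma>\<close> is (a version of) the conditional support of \<open>X\<close> given \<open>N\<close>.\<close>

definition is_cond_support ::
    "'a measure \<Rightarrow> 'a measure \<Rightarrow> ('a \<Rightarrow> 'b::topological_space) \<Rightarrow> ('a \<Rightarrow> 'b set) \<Rightarrow> bool"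
  where "is_cond_support M N X \<Gamma> \<longleftrightarrow>
    random_closed_set N \<Gamma> \<and> (AE \<omega> in M. X \<omega> \<in> \<Gamma> \<omega>) \<and>
    (\<forall>\<Gamma>'. random_closed_set N \<Gamma>' \<and> (AE \<omega> in M. X \<omega> \<in> \<Gamma>' \<omega>) \<longrightarrow> (AE \<omega> in M. \<Gamma> \<omega> \<subseteq> \<Gamma>' \<omega>))"


section \<open>The market\<close>

text \<open>The index type \<open>'d\<close> of the assets carries a designated element \<open>c\<close>, the cash account:
  \<open>z $ c\<close> is \<open>z\<^sup>1\<close>, \<open>axis c 1\<close> is \<open>e\<^sub>1\<close>, and \<open>risky c z\<close> is \<open>(0, z\<^sup>(\<^sup>2\<^sup>))\<close>.\<close>

definition risky :: "'d \<Rightarrow> real^'d \<Rightarrow> real^'d::finite"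
  where "risky c z = (\<chi> j. if j = c then 0 else z $ j)"

definition nonneg_vec :: "real^'n::finite \<Rightarrow> bool"
  where "nonneg_vec x \<longleftrightarrow> (\<forall>j. 0 \<le> x $ j)"

text \<open>The set \<open>G\<^sub>t\<close> as a function of the price \<open>s\<close>, for the cost function \<open>K = C\<^sub>t\<close>.\<close>

definition solvency :: "('s \<Rightarrow> real^'d \<Rightarrow> real) \<Rightarrow> 's \<Rightarrow> (real^'d::finite) set"
  where "solvency K s = {z. - K s (- z) \<ge> 0}"

locale cost_market = prob_space M
  for M :: "'a measure"
    and F :: "nat \<Rightarrow> 'a measure"
    and T :: nat
    and S :: "nat \<Rightarrow> 'a \<Rightarrow> real^'m::finite"
    and C :: "nat \<Rightarrow> real^'m \<Rightarrow> real^'d::finite \<Rightarrow> real"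
    and c :: 'd +
  assumes dims: "CARD('d) \<le> CARD('m)"
    and filtration_subalgebra: "\<And>t. t \<le> T \<Longrightarrow> subalgebra M (F t)"
    and filtration_mono: "\<And>s t. s \<le> t \<Longrightarrow> t \<le> T \<Longrightarrow> sets (F s) \<subseteq> sets (F t)"
    and filtration_complete: "\<And>A N. N \<in> null_sets M \<Longrightarrow> A \<subseteq> N \<Longrightarrow> A \<in> sets (F 0)"
    and price_adapted: "\<And>t. t \<le> T \<Longrightarrow> S t \<in> borel_measurable (F t)"
    and price_nonneg: "\<And>t \<omega>. t \<le> T \<Longrightarrow> \<omega> \<in> space M \<Longrightarrow> nonneg_vec (S t \<omega>)"
    and cost_borel: "\<And>t. t \<le> T \<Longrightarrow> (\<lambda>(s, x). C t s x) \<in> borel_measurable borel"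
    and cost_lsc: "\<And>t. t \<le> T \<Longrightarrow> lsc (\<lambda>(s, x). C t s x)"
    and cost_zero: "\<And>t s. t \<le> T \<Longrightarrow> nonneg_vec s \<Longrightarrow> C t s 0 = 0"
    and cost_cash: "\<And>t s x r. t \<le> T \<Longrightarrow> nonneg_vec s \<Longrightarrow>
          C t s (x + r *\<^sub>R axis c 1) = C t s x + r"
    and cost_mono_T: "\<And>s x1 x2. nonneg_vec s \<Longrightarrow> nonneg_vec (x2 - x1) \<Longrightarrow> C T s x1 \<le> C T s x2"
    and cost_dominated: "\<And>t. t \<le> T \<Longrightarrow>
          \<exists>h. continuous_on UNIV h \<and> (\<forall>s x. nonneg_vec s \<longrightarrow> \<bar>C t s x\<bar> \<le> h (s, x))"
    and solvency_upward: "\<And>t. t \<le> T \<Longrightarrow>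
          AE \<omega> in M. \<forall>z\<in>solvency (C t) (S t \<omega>). \<forall>r. nonneg_vec r \<longrightarrow> z + r \<in> solvency (C t) (S t \<omega>)"

text \<open>The increments of a family \<open>V\<^sub>t, V\<^sub>t\<^sub>+\<^sub>1, \<dots>\<close> whose entry at time \<open>t - 1\<close> is \<open>v\<close>;
  keeping \<open>v\<close> separate avoids the time index \<open>-1\<close>.\<close>

definition increment ::
    "nat \<Rightarrow> ('a \<Rightarrow> real^'d::finite) \<Rightarrow> (nat \<Rightarrow> 'a \<Rightarrow> real^'d) \<Rightarrow> nat \<Rightarrow> 'a \<Rightarrow> real^'d"
  where "increment t v V s \<omega> = V s \<omega> - (if s = t then v \<omega> else V (s - 1) \<omega>)"

definition portfolio_process ::
    "'a measure \<Rightarrow> (nat \<Rightarrow> 'a measure) \<Rightarrow> nat \<Rightarrow> (nat \<Rightarrow> 'a \<Rightarrow> real^'m::finite) \<Rightarrow>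
     (nat \<Rightarrow> real^'m \<Rightarrow> real^'d::finite \<Rightarrow> real) \<Rightarrow> 'd \<Rightarrow> real \<Rightarrow> (nat \<Rightarrow> 'a \<Rightarrow> real^'d) \<Rightarrow> bool"
  where "portfolio_process M F T S C c x V \<longleftrightarrow>
    (\<forall>s\<le>T. V s \<in> borel_measurable (F s) \<and>
      (AE \<omega> in M. increment 0 (\<lambda>_. x *\<^sub>R axis c 1) V s \<omega> \<in> uminus ` solvency (C s) (S s \<omega>)))"

definition hedgeable ::
    "'a measure \<Rightarrow> (nat \<Rightarrow> 'a measure) \<Rightarrow> nat \<Rightarrow> (nat \<Rightarrow> 'a \<Rightarrow> real^'m::finite) \<Rightarrow>
     (nat \<Rightarrow> real^'m \<Rightarrow> real^'d::finite \<Rightarrow> real) \<Rightarrow> 'd \<Rightarrow> ('a \<Rightarrow> real^'d) \<Rightarrow> bool"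
  where "hedgeable M F T S C c \<xi> \<longleftrightarrow>
    (\<exists>x V. portfolio_process M F T S C c x V \<and> (AE \<omega> in M. V T \<omega> = \<xi> \<omega>))"


section \<open>Hedging costs\<close>

text \<open>A family of \<open>(d-1)\<close>-dimensional positions is represented by a family of \<open>d\<close>-dimensional ones,
  of which only the risky components enter the terminal condition and the costs.\<close>

definition strategies ::
    "'a measure \<Rightarrow> (nat \<Rightarrow> 'a measure) \<Rightarrow> nat \<Rightarrow> 'd::finite \<Rightarrow> nat \<Rightarrow> ('a \<Rightarrow> real^'d) \<Rightarrow>
     (nat \<Rightarrow> 'a \<Rightarrow> real^'d) set"
  where "strategies M F T c t \<xi> = {V. (\<forall>s\<in>{t..<T}. V s \<in> borel_measurable (F s)) \<and>
    (\<forall>\<omega>\<in>space M. risky c (V T \<omega>) = risky c (\<xi> \<omega>))}"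

definition strategy_cost ::
    "nat \<Rightarrow> (nat \<Rightarrow> 'a \<Rightarrow> real^'m::finite) \<Rightarrow> (nat \<Rightarrow> real^'m \<Rightarrow> real^'d::finite \<Rightarrow> real) \<Rightarrow> 'd \<Rightarrow>
     ('a \<Rightarrow> real^'d) \<Rightarrow> nat \<Rightarrow> ('a \<Rightarrow> real^'d) \<Rightarrow> (nat \<Rightarrow> 'a \<Rightarrow> real^'d) \<Rightarrow> 'a \<Rightarrow> real"
  where "strategy_cost T S C c \<xi> t v V \<omega> =
    \<xi> \<omega> $ c + (\<Sum>s=t..T. C s (S s \<omega>) (risky c (increment t v V s \<omega>)))"

text \<open>\<open>hedging_cost M F T S C c \<xi> t v\<close> is \<open>\<gamma>\<close> at time \<open>t\<close> for the payoff \<open>\<xi>\<close> and \<open>V\<^sub>t\<^sub>-\<^sub>1 = v\<close>.\<close>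

definition hedging_cost ::
    "'a measure \<Rightarrow> (nat \<Rightarrow> 'a measure) \<Rightarrow> nat \<Rightarrow> (nat \<Rightarrow> 'a \<Rightarrow> real^'m::finite) \<Rightarrow>
     (nat \<Rightarrow> real^'m \<Rightarrow> real^'d::finite \<Rightarrow> real) \<Rightarrow> 'd \<Rightarrow>
     ('a \<Rightarrow> real^'d) \<Rightarrow> nat \<Rightarrow> ('a \<Rightarrow> real^'d) \<Rightarrow> 'a \<Rightarrow> ereal"
  where "hedging_cost M F T S C c \<xi> t v =
    cond_ess_inf M (F t)
      ((\<lambda>V. cond_ess_sup M (F t) {\<lambda>\<omega>. ereal (strategy_cost T S C c \<xi> t v V \<omega>)})
        ` strategies M F T c t \<xi>)"

definition AEP ::
    "'a measure \<Rightarrow> (nat \<Rightarrow> 'a measure) \<Rightarrow> nat \<Rightarrow> (nat \<Rightarrow> 'a \<Rightarrow> real^'m::finite) \<Rightarrow>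
     (nat \<Rightarrow> real^'m \<Rightarrow> real^'d::finite \<Rightarrow> real) \<Rightarrow> 'd \<Rightarrow> bool"
  where "AEP M F T S C c \<longleftrightarrow>
    (\<forall>t\<le>T. \<forall>V\<in>borel_measurable (F t). AE \<omega> in M. hedging_cost M F T S C c (\<lambda>_. 0) t V \<omega> > -\<infinity>)"

end

theory Submission
  imports Defs
begin

text \<open>
  Let \<open>f s y\<close> be the supremum of \<open>g (\<alpha> t k s) y\<close> over \<open>k \<ge> 1\<close>. The recursion rests on three identities.

  First, \<open>f (S t) W\<close> is the conditional essential supremum, given time \<open>t\<close>, of the next hedging cost
  \<open>g (S (Suc t)) W\<close>. If \<open>g\<close> is lower semicontinuous, its supremum over the conditional support is the supremum over
  a dense sequence, and no smaller bound is possible because the sublevel sets of \<open>g\<close> at the level of a bound form a random closed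
  set containing \<open>S (Suc t)\<close> (\<open>cond_support_dominates\<close>, \<open>cond_support_least\<close>). In the
  other case every \<open>\<alpha> t k (S t)\<close> is hit with positive conditional probability (\<open>cond_atoms_least\<close>).

  Second, a Bellman principle: the hedging cost at time \<open>t\<close> is the essential infimum over positions \<open>W\<close>, known at time \<open>t\<close>, of the
  trading cost from \<open>v\<close> to \<open>W\<close> plus that essential supremum (\<open>hedging_cost_Suc_le\<close>,
  \<open>hedging_cost_le_on\<close>). The inequality that needs work holds since an essential infimum is an infimum of countably many
  members (\<open>ess_inf_sequence\<close>) and since strategies can be pasted along an index known at the time.

  Third, the essential infimum over random positions is the pointwise infimum over \<open>y\<close>. As the integrand is only Borel in
  price and position, this is a question of measurable selection, and even the measurability of the pointwise infimum is a
  question about projections of Borel sets. Both are settled by \<open>borel_measurable_selection\<close>, which is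
  derived from Choquet's \<open>capacitability\<close>: a Borel set contains compact sets whose projections have
  nearly the full outer measure, and compact sets have Borel selections by lexicographic minimization. Completeness of the
  filtration absorbs the exceptional null sets.

  If the trading cost is convex, the new function is an infimal convolution of convex functions, hence convex. Since trading
  costs are finite, it is constantly \<open>\<infinity>\<close>, constantly \<open>-\<infinity>\<close> or real-valued and therefore continuous in
  every case. Being measurable in \<open>\<omega>\<close> for each position and continuous in the position, it is
  a normal integrand.
\<close>

section \<open>Borel sets as projections of closed sets\<close>

text \<open>The analytic (Suslin) sets, coded by closed sets over Baire space. This code makes closure under
  countable unions and intersections a matter of rearranging sequences of integers.\<close>

definition suslin :: "'a::topological_space set \<Rightarrow> bool"
  where "suslin A \<longleftrightarrow> (\<exists>R :: ('a \<times> (nat \<Rightarrow> nat)) set. closed R \<and> A = fst ` R)"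

lemma suslin_closed: "closed A \<Longrightarrow> suslin A"
  unfolding suslin_def by (intro exI[of _ "A \<times> UNIV"]) (auto simp: closed_Times)

lemma continuous_on_snd_coordinate:
  "continuous_on UNIV (\<lambda>p :: 'a::topological_space \<times> (nat \<Rightarrow> nat). snd p j)"
  by (rule continuous_on_product_then_coordinatewise[OF continuous_on_snd[OF continuous_on_id]])

text \<open>The first entry of the code says which of the sets the point belongs to.\<close>

lemma suslin_UN:
  fixes A :: "nat \<Rightarrow> 'a::topological_space set"
  assumes "\<And>n. suslin (A n)"
  shows "suslin (\<Union>n. A n)"
proof -
  obtain R :: "nat \<Rightarrow> ('a \<times> (nat \<Rightarrow> nat)) set"
    where R: "\<And>n. closed (R n)" "\<And>n. A n = fst ` R n"
    using assms unfolding suslin_def by metis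
  define Q where "Q n = {p :: 'a \<times> (nat \<Rightarrow> nat). snd p 0 = n}" for n
  have cont: "continuous_on UNIV (\<lambda>p :: 'a \<times> (nat \<Rightarrow> nat). (fst p, \<lambda>i. snd p (Suc i)))"
    by (intro continuous_on_Pair continuous_on_fst continuous_on_id
        continuous_on_coordinatewise_then_product continuous_on_snd_coordinate)
  define P where "P = {p :: 'a \<times> (nat \<Rightarrow> nat). (fst p, \<lambda>i. snd p (Suc i)) \<in> R (snd p 0)}"
  have openQ: "open (Q n)" for n
  proof -
    have "open ((\<lambda>p :: 'a \<times> (nat \<Rightarrow> nat). snd p 0) -` {n})"
      by (intro open_vimage Topological_Spaces.open_discrete continuous_on_snd_coordinate)
    then show ?thesis by (simp add: Q_def vimage_def)
  qed
  have "- P = (\<Union>n. Q n \<inter> ((\<lambda>p. (fst p, \<lambda>i. snd p (Suc i))) -` (- R n)))"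
    by (auto simp: P_def Q_def)
  moreover have "open \<dots>"
    by (intro open_UN ballI open_Int openQ open_vimage cont) (simp add: R open_Compl)
  ultimately have "closed P" by (simp add: closed_def)
  moreover have "(\<Union>n. A n) = fst ` P"
  proof (intro equalityI subsetI)
    fix x assume "x \<in> (\<Union>n. A n)"
    then obtain n \<sigma> where "(x, \<sigma>) \<in> R n" using R(2) by fastforce
    then have "(x, case_nat n \<sigma>) \<in> P" by (simp add: P_def)
    then show "x \<in> fst ` P" by force
  qed (use R(2) in \<open>force simp: P_def\<close>)
  ultimately show ?thesis unfolding suslin_def by blast
qed

text \<open>Countably many codes are interleaved into one along the pairing function.\<close>

lemma suslin_INT:
  fixes A :: "nat \<Rightarrow> 'a::topological_space set"
  assumes "\<And>n. suslin (A n)"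
  shows "suslin (\<Inter>n. A n)"
proof -
  obtain R :: "nat \<Rightarrow> ('a \<times> (nat \<Rightarrow> nat)) set"
    where R: "\<And>n. closed (R n)" "\<And>n. A n = fst ` R n"
    using assms unfolding suslin_def by metis
  define P where
    "P = (\<Inter>n. (\<lambda>p :: 'a \<times> (nat \<Rightarrow> nat). (fst p, \<lambda>i. snd p (prod_encode (n, i)))) -` R n)"
  have "continuous_on UNIV (\<lambda>p :: 'a \<times> (nat \<Rightarrow> nat). (fst p, \<lambda>i. snd p (prod_encode (n, i))))" for n
    by (intro continuous_on_Pair continuous_on_fst continuous_on_id
        continuous_on_coordinatewise_then_product continuous_on_snd_coordinate)
  then have "closed P"
    unfolding P_def by (intro closed_INT ballI closed_vimage R(1)) 
  moreover have "(\<Inter>n. A n) = fst ` P"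
  proof (intro equalityI subsetI)
    fix x assume x: "x \<in> (\<Inter>n. A n)"
    have "\<exists>\<sigma>. (x, \<sigma>) \<in> R n" for n using x R(2)[of n] by force
    then obtain \<sigma> where "\<And>n. (x, \<sigma> n) \<in> R n" by metis
    then have "(x, \<lambda>j. case prod_decode j of (n, i) \<Rightarrow> \<sigma> n i) \<in> P" by (simp add: P_def)
    then show "x \<in> fst ` P" by force
  qed (use R(2) in \<open>force simp: P_def\<close>)
  ultimately show ?thesis unfolding suslin_def by blast
qed

text \<open>Complements of analytic sets need not be analytic, so the induction over the Borel sets carries a
  set and its complement together.\<close>

lemma suslin_borel:
  fixes A :: "'a::metric_space set"
  assumes "A \<in> sets borel"
  shows "suslin A"
proof -
  have op: "suslin U" if "open U" for U :: "'a set"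
  proof -
    have "fsigma_in euclidean U"
      using that by (intro open_imp_fsigma_in) (auto simp: metrizable_space_euclidean)
    then obtain K :: "nat \<Rightarrow> 'a set" where "\<And>n. closed (K n)" "U = (\<Union>n. K n)"
      unfolding fsigma_in_ascending by auto
    then show ?thesis using suslin_UN suslin_closed by metis
  qed
  have "A \<in> sigma_sets UNIV {U. open U}" using assms by (simp add: borel_def)
  then have "suslin A \<and> suslin (- A)"
  proof induction
    case (Basic U) then show ?case by (simp add: op suslin_closed closed_Compl)
  next
    case Empty show ?case by (simp add: suslin_closed)
  next
    case (Compl a) then show ?case by (simp add: Compl_eq_Diff_UNIV[symmetric])
  next
    case (Union a)
    moreover have "- (\<Union>i. a i) = (\<Inter>i. - a i)" by blast
    ultimately show ?case using suslin_UN[of a] suslin_INT[of "\<lambda>i. - a i"] by auto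
  qed
  then show ?thesis by simp
qed

section \<open>Capacitability\<close>

text \<open>Choquet's capacitability argument for the capacity \<open>A \<mapsto> \<mu>\<^sup>*(\<pi> A)\<close>. The outer measure is continuous
  along increasing unions, so one may cut \<open>R\<close> down by bounds \<open>Q 0 (b 0)\<close>, \<open>Q 1 (b 1)\<close>, \<dots>,
  chosen one after the other, while the capacity stays above \<open>a\<close>. What is left is compact, and a compactness argument
  shows that every open set around its image already contains the image of a finite stage;
  outer regularity concludes.\<close>

lemma capacitability:
  fixes \<mu> :: "'x::polish_space measure" and \<pi> :: "'z::first_countable_topology \<Rightarrow> 'x"
    and Q :: "nat \<Rightarrow> nat \<Rightarrow> 'z set"
  assumes sb: "sets \<mu> = sets borel" and fin: "emeasure \<mu> (space \<mu>) \<noteq> \<infinity>"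
    and cont: "continuous_on UNIV \<pi>" and R: "closed R"
    and Q_closed: "\<And>i k. closed (Q i k)" and Q_mono: "\<And>i. incseq (Q i)"
    and Q_UN: "\<And>i. (\<Union>k. Q i k) = UNIV" and Q_compact: "\<And>b. compact (\<Inter>i. Q i (b i))"
    and a: "a < outer_measure_of \<mu> (\<pi> ` R)"
  obtains L where "compact L" "L \<subseteq> R" "a \<le> emeasure \<mu> (\<pi> ` L)"
proof -
  have sp: "space \<mu> = UNIV" using sets_eq_imp_space_eq[OF sb] by simp
  have step: "\<exists>k. a < outer_measure_of \<mu> (\<pi> ` (A \<inter> Q i k))"
    if "a < outer_measure_of \<mu> (\<pi> ` A)" for A i
  proof -
    have "(\<Union>k. \<pi> ` (A \<inter> Q i k)) = \<pi> ` A" using Q_UN[of i] by blast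
    moreover have "incseq (\<lambda>k. \<pi> ` (A \<inter> Q i k))"
      using Q_mono[of i] unfolding incseq_def by (meson Int_mono image_mono order_refl)
    ultimately have "(SUP k. outer_measure_of \<mu> (\<pi> ` (A \<inter> Q i k))) = outer_measure_of \<mu> (\<pi> ` A)"
      using SUP_outer_measure_of_incseq[of "\<lambda>k. \<pi> ` (A \<inter> Q i k)" \<mu>] by (simp add: sp)
    then have "a < (SUP k. outer_measure_of \<mu> (\<pi> ` (A \<inter> Q i k)))" using that by simp
    then show ?thesis unfolding less_SUP_iff by blast
  qed
  define next_set where
    "next_set i A = A \<inter> Q i (SOME k. a < outer_measure_of \<mu> (\<pi> ` (A \<inter> Q i k)))" for i A
  define Rn where "Rn = rec_nat R next_set"
  define b where "b i = (SOME k. a < outer_measure_of \<mu> (\<pi> ` (Rn i \<inter> Q i k)))" for i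
  have Rn_0: "Rn 0 = R" and Rn_Suc: "Rn (Suc i) = Rn i \<inter> Q i (b i)" for i
    by (simp_all add: Rn_def b_def next_set_def)
  have Rn_a: "a < outer_measure_of \<mu> (\<pi> ` Rn i)" for i
  proof (induction i)
    case (Suc i) show ?case using someI_ex[OF step[OF Suc, of i]] by (simp add: Rn_Suc b_def)
  qed (simp add: Rn_0 a)
  have Rn_eq: "Rn n = R \<inter> (\<Inter>i<n. Q i (b i))" for n
    by (induction n) (auto simp: Rn_0 Rn_Suc lessThan_Suc)
  define L where "L = R \<inter> (\<Inter>i. Q i (b i))"
  have compact_L: "compact L" unfolding L_def by (intro closed_Int_compact R Q_compact)
  have compact_piL: "compact (\<pi> ` L)"
    by (intro compact_continuous_image compact_L continuous_on_subset[OF cont]) simp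
  have "a \<le> emeasure \<mu> U" if U: "\<pi> ` L \<subseteq> U" "open U" for U
  proof -
    have "\<exists>n. \<pi> ` Rn n \<subseteq> U"
    proof (rule ccontr)
      assume "\<nexists>n. \<pi> ` Rn n \<subseteq> U"
      then have "\<exists>z. z \<in> Rn n \<and> \<pi> z \<notin> U" for n by blast
      then obtain z where z: "\<And>n. z n \<in> Rn n" "\<And>n. \<pi> (z n) \<notin> U" by metis
      have late: "z n \<in> Q i (b i)" if "i < n" for n i using z(1)[of n] that by (auto simp: Rn_eq)
      have "\<exists>k. z n \<in> Q i k" for n i using Q_UN[of i] by blast
      then obtain k where k: "\<And>n i. z n \<in> Q i (k n i)" by metis
      \<comment> \<open>The point \<open>z n\<close> respects the bound \<open>b i\<close> only for \<open>i < n\<close>; each coordinate thus has finitely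
        many exceptions, and enlarging the bounds to \<open>b'\<close> puts the whole sequence into one compact set.\<close>
      define b' where "b' i = Max (insert (b i) ((\<lambda>n. k n i) ` {..i}))" for i
      have "z n \<in> Q i (b' i)" for n i
      proof (cases "i < n")
        case True
        have "b i \<le> b' i" by (simp add: b'_def)
        then show ?thesis using late[OF True] Q_mono[of i] by (auto simp: incseq_def)
      next
        case False
        then have "k n i \<le> b' i" unfolding b'_def by (intro Max_ge) auto
        then show ?thesis using k[of n i] Q_mono[of i] by (auto simp: incseq_def)
      qed
      then have "\<forall>n. z n \<in> (\<Inter>i. Q i (b' i))" by blast
      then have "\<exists>l\<in>\<Inter>i. Q i (b' i). \<exists>r. strict_mono (r :: nat \<Rightarrow> nat) \<and> (z \<circ> r) \<longlonglongrightarrow> l"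
        by (rule compact_imp_seq_compact[OF Q_compact, unfolded seq_compact_def, THEN spec, THEN mp])
      then obtain l r where l: "strict_mono (r :: nat \<Rightarrow> nat)" "(z \<circ> r) \<longlonglongrightarrow> l"
        by blast
      have "l \<in> R"
        using closed_sequentially[OF R _ l(2)] z(1) by (simp add: Rn_eq)
      moreover have "l \<in> Q i (b i)" for i
      proof (rule closed_sequentially[OF Q_closed])
        show "(z \<circ> r) (n + Suc i) \<in> Q i (b i)" for n
          using seq_suble[OF l(1), of "n + Suc i"] by (auto intro!: late)
        show "(\<lambda>n. (z \<circ> r) (n + Suc i)) \<longlonglongrightarrow> l" using l(2) by (rule LIMSEQ_ignore_initial_segment)
      qed
      ultimately have "\<pi> l \<in> U" using U(1) by (auto simp: L_def)
      moreover have "closed (\<pi> -` (- U))" using U(2) cont by (intro closed_vimage) auto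
      then have "l \<in> \<pi> -` (- U)"
        using z(2) by (intro closed_sequentially[OF _ _ l(2)]) auto
      ultimately show False by simp
    qed
    then obtain n where "\<pi> ` Rn n \<subseteq> U" by blast
    then have "outer_measure_of \<mu> (\<pi> ` Rn n) \<le> outer_measure_of \<mu> U" by (rule outer_measure_of_mono)
    then show ?thesis using Rn_a[of n] U(2) sb by simp
  qed
  then have "a \<le> emeasure \<mu> (\<pi> ` L)"
    using compact_piL
    by (subst outer_regular[OF sb fin]) (auto intro!: INF_greatest simp: compact_imp_closed)
  then show ?thesis using that compact_L by (auto simp: L_def)
qed

section \<open>Selections of compact-valued maps\<close>

text \<open>Measurability of a set-valued map in the sense of hitting closed sets.\<close>

definition compact_multifunction :: "('x::topological_space \<Rightarrow> 'y::topological_space set) \<Rightarrow> bool"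
  where "compact_multifunction k \<longleftrightarrow>
    (\<forall>x. compact (k x)) \<and> (\<forall>W. closed W \<longrightarrow> {x. k x \<inter> W \<noteq> {}} \<in> sets borel)"

definition minimizers :: "('y \<Rightarrow> real) \<Rightarrow> ('x \<Rightarrow> 'y set) \<Rightarrow> 'x \<Rightarrow> 'y set"
  where "minimizers h k x = {y \<in> k x. \<forall>z\<in>k x. h y \<le> h z}"

lemma minimizers_nonempty:
  fixes h :: "'y::topological_space \<Rightarrow> real"
  assumes "compact_multifunction k" "continuous_on UNIV h" "k x \<noteq> {}"
  shows "minimizers h k x \<noteq> {}"
proof -
  have "compact (k x)" "continuous_on (k x) h"
    using assms continuous_on_subset[of UNIV h "k x"] by (auto simp: compact_multifunction_def)
  then show ?thesis
    using continuous_attains_inf[of "k x" h] assms(3) by (auto simp: minimizers_def)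
qed

text \<open>The minimizers over \<open>k x\<close> meet \<open>W\<close> iff the minimum of \<open>h\<close> over \<open>k x \<inter> W\<close> is no larger than
  the minimum over \<open>k x\<close>. Both minima are attained, so rational levels suffice to compare them.\<close>

lemma compact_multifunction_minimizers:
  fixes h :: "'y::t2_space \<Rightarrow> real"
  assumes k: "compact_multifunction k" and h: "continuous_on UNIV h"
  shows "compact_multifunction (minimizers h k)"
  unfolding compact_multifunction_def
proof (intro conjI allI impI)
  have ck: "compact (k x)" for x using k by (simp add: compact_multifunction_def)
  have closed_le: "closed {y. h y \<le> a}" for a
    by (intro closed_Collect_le h continuous_on_const)
  fix x
  have "minimizers h k x = k x \<inter> (\<Inter>z\<in>k x. {y. h y \<le> h z})"
    by (auto simp: minimizers_def)
  then show "compact (minimizers h k x)"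
    by (auto intro!: compact_Int_closed ck closed_INT closed_le)
next
  have ck: "compact (k x)" for x using k by (simp add: compact_multifunction_def)
  have closed_le: "closed {y. h y \<le> a}" for a
    by (intro closed_Collect_le h continuous_on_const)
  fix W :: "'y set" assume W: "closed W"
  have hit: "{x. k x \<inter> V \<noteq> {}} \<in> sets borel" if "closed V" for V
    using k that by (simp add: compact_multifunction_def)
  have "{x. minimizers h k x \<inter> W \<noteq> {}} = {x. k x \<inter> W \<noteq> {}} \<inter>
    (\<Inter>q\<in>\<rat>. - {x. k x \<inter> {y. h y \<le> q} \<noteq> {}} \<union> {x. k x \<inter> (W \<inter> {y. h y \<le> q}) \<noteq> {}})"
    (is "?L = ?R")
  proof (intro equalityI subsetI)
    fix x assume "x \<in> ?L"
    then obtain y where "y \<in> k x" "y \<in> W" "\<forall>z\<in>k x. h y \<le> h z" by (auto simp: minimizers_def)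
    then show "x \<in> ?R" by (auto intro: order_trans)
  next
    fix x assume x: "x \<in> ?R"
    have "compact (k x \<inter> W)" by (intro compact_Int_closed ck W)
    then obtain y where y: "y \<in> k x \<inter> W" "\<And>z. z \<in> k x \<inter> W \<Longrightarrow> h y \<le> h z"
      using continuous_attains_inf[of "k x \<inter> W" h] x continuous_on_subset[OF h] by blast
    have "h y \<le> h z" if z: "z \<in> k x" for z
    proof (rule ccontr)
      assume "\<not> h y \<le> h z"
      then obtain q where q: "q \<in> \<rat>" "h z < q" "q < h y" using Rats_dense_in_real[of "h z" "h y"] by auto
      then have "k x \<inter> {y. h y \<le> q} \<noteq> {}" using z by force
      then have "k x \<inter> (W \<inter> {y. h y \<le> q}) \<noteq> {}" using x q(1) by blast
      then show False using y(2) q(3) by force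
    qed
    then show "x \<in> ?L" using y(1) by (auto simp: minimizers_def)
  qed
  also have "\<dots> \<in> sets borel"
    by (intro sets.Int sets.countable_INT' sets.Un borel_comp hit W closed_Int closed_le)
      (use countable_rat Rats_0 in \<open>auto intro!: sets.Un borel_comp hit W closed_Int closed_le\<close>)
  finally show "{x. minimizers h k x \<inter> W \<noteq> {}} \<in> sets borel" .
qed

text \<open>Lexicographic minimization: minimizing one coordinate after the other keeps the values
  compact and nonempty, and once all coordinates are constant on each value, one point is left.\<close>

lemma compact_multifunction_selection:
  fixes k :: "'x::topological_space \<Rightarrow> 'y::euclidean_space set"
  assumes k: "compact_multifunction k"
  obtains \<phi> where "\<phi> \<in> borel_measurable borel" "\<And>x. k x \<noteq> {} \<Longrightarrow> \<phi> x \<in> k x"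
proof -
  have "\<exists>k'. compact_multifunction k' \<and> (\<forall>x. k' x \<subseteq> k x \<and> (k x \<noteq> {} \<longrightarrow> k' x \<noteq> {}) \<and>
      (\<forall>b\<in>B. \<forall>y\<in>k' x. \<forall>z\<in>k' x. y \<bullet> b = z \<bullet> b))" if "finite B" for B :: "'y set"
    using that
  proof induction
    case empty show ?case using k by auto
  next
    case (insert b B)
    then obtain k' where k': "compact_multifunction k'"
      and k'_props: "\<forall>x. k' x \<subseteq> k x \<and> (k x \<noteq> {} \<longrightarrow> k' x \<noteq> {}) \<and>
        (\<forall>b\<in>B. \<forall>y\<in>k' x. \<forall>z\<in>k' x. y \<bullet> b = z \<bullet> b)" by blast
    let ?m = "minimizers (\<lambda>y. y \<bullet> b) k'"
    have h: "continuous_on UNIV (\<lambda>y :: 'y. y \<bullet> b)" by (intro continuous_intros)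
    have sub: "?m x \<subseteq> k' x" for x by (auto simp: minimizers_def)
    have const: "y \<bullet> b' = z \<bullet> b'" if "b' \<in> insert b B" "y \<in> ?m x" "z \<in> ?m x" for x b' y z
    proof (cases "b' = b")
      case True then show ?thesis using that by (auto simp: minimizers_def intro: antisym)
    next
      case False then show ?thesis using that sub[of x] k'_props by blast
    qed
    have "?m x \<subseteq> k x" for x
      using sub[of x] k'_props by (meson order_trans)
    moreover have "k x \<noteq> {} \<longrightarrow> ?m x \<noteq> {}" for x
      using minimizers_nonempty[OF k' h, of x] k'_props by simp
    ultimately show ?case
      using compact_multifunction_minimizers[OF k' h] const
      by (intro exI[of _ ?m] conjI allI ballI) assumption+
  qed
  from this[OF finite_Basis] obtain k' where k': "compact_multifunction k'"
    and k'_props: "\<forall>x. k' x \<subseteq> k x \<and> (k x \<noteq> {} \<longrightarrow> k' x \<noteq> {}) \<and>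
      (\<forall>b\<in>Basis. \<forall>y\<in>k' x. \<forall>z\<in>k' x. y \<bullet> b = z \<bullet> b)" by blast
  have unique: "y = z" if "y \<in> k' x" "z \<in> k' x" for x y z
  proof (rule euclidean_eqI)
    fix b :: 'y assume "b \<in> Basis"
    then show "y \<bullet> b = z \<bullet> b"
      by (rule bspec[OF bspec[OF bspec[OF spec[OF k'_props, THEN conjunct2, THEN conjunct2]]]])
        (rule that)+
  qed
  define \<phi> where "\<phi> x = (if k' x = {} then 0 else SOME y. y \<in> k' x)" for x
  have \<phi>: "\<phi> x \<in> k' x" if "k' x \<noteq> {}" for x using that by (auto simp: \<phi>_def some_in_eq)
  have "\<phi> -` W \<in> sets borel" if W: "closed W" for W
  proof -
    have hit: "{x. k' x \<inter> V \<noteq> {}} \<in> sets borel" if "closed V" for V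
      using k' that by (simp add: compact_multifunction_def)
    have "\<phi> -` W = {x. k' x \<inter> W \<noteq> {}} \<union> (if 0 \<in> W then - {x. k' x \<inter> UNIV \<noteq> {}} else {})"
    proof (intro set_eqI)
      fix x show "x \<in> \<phi> -` W \<longleftrightarrow>
        x \<in> {x. k' x \<inter> W \<noteq> {}} \<union> (if 0 \<in> W then - {x. k' x \<inter> UNIV \<noteq> {}} else {})"
      proof (cases "k' x = {}")
        case True then show ?thesis by (simp add: \<phi>_def)
      next
        case False
        then have "k' x = {\<phi> x}" using \<phi>[of x] unique[of _ x "\<phi> x"] by blast
        then show ?thesis by simp
      qed
    qed
    then show ?thesis
      using hit[OF W] hit[of UNIV] by auto
  qed
  then have "\<phi> \<in> borel_measurable borel"
    unfolding borel_eq_closed[where 'a='y] by (intro measurable_measure_of) auto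
  moreover have "\<phi> x \<in> k x" if "k x \<noteq> {}" for x using that \<phi>[of x] k'_props by blast
  ultimately show ?thesis using that by blast
qed

section \<open>Measurable selection from Borel sets\<close>

lemma compact_selection:
  fixes K :: "('x::t2_space \<times> 'y::euclidean_space) set"
  assumes K: "compact K"
  obtains \<phi> where "\<phi> \<in> borel_measurable borel" "\<And>x. x \<in> fst ` K \<Longrightarrow> (x, \<phi> x) \<in> K"
proof -
  have "compact_multifunction (\<lambda>x. {y. (x, y) \<in> K})"
    unfolding compact_multifunction_def
  proof (intro conjI allI impI)
    fix x :: 'x
    have "closed ({x} \<times> (UNIV :: 'y set))" by (intro closed_Times closed_singleton closed_UNIV)
    then have "compact (snd ` (K \<inter> {x} \<times> UNIV))"
      by (intro compact_continuous_image compact_Int_closed K continuous_intros)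
    moreover have "snd ` (K \<inter> {x} \<times> UNIV) = {y. (x, y) \<in> K}" by force
    ultimately show "compact {y. (x, y) \<in> K}" by simp
  next
    fix W :: "'y set" assume "closed W"
    then have "closed ((UNIV :: 'x set) \<times> W)" by (intro closed_Times) auto
    then have "compact (fst ` (K \<inter> UNIV \<times> W))"
      by (intro compact_continuous_image compact_Int_closed K continuous_intros)
    moreover have "fst ` (K \<inter> UNIV \<times> W) = {x. {y. (x, y) \<in> K} \<inter> W \<noteq> {}}" by force
    ultimately show "{x. {y. (x, y) \<in> K} \<inter> W \<noteq> {}} \<in> sets borel"
      by (metis compact_imp_closed borel_closed)
  qed
  then obtain \<phi> where "\<phi> \<in> borel_measurable borel"
    "\<And>x. {y. (x, y) \<in> K} \<noteq> {} \<Longrightarrow> \<phi> x \<in> {y. (x, y) \<in> K}"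
    by (rule compact_multifunction_selection) blast
  then show ?thesis using that by force
qed

text \<open>The bounds fed into the capacitability argument are a ball for the point and, for each \<open>j\<close>, an initial
  segment for the entry \<open>j\<close> of its code. Together they confine the pair to a compact
  set by Tychonoff's theorem.\<close>

lemma suslin_inner_compact:
  fixes B :: "('x::euclidean_space \<times> 'y::euclidean_space) set"
  assumes sb: "sets \<mu> = sets borel" and fin: "emeasure \<mu> (space \<mu>) \<noteq> \<infinity>"
    and B: "suslin B" and a: "a < outer_measure_of \<mu> (fst ` B)"
  obtains K where "compact K" "K \<subseteq> B" "a \<le> emeasure \<mu> (fst ` K)"
proof -
  obtain R :: "(('x \<times> 'y) \<times> (nat \<Rightarrow> nat)) set" where R: "closed R" "B = fst ` R"
    using B unfolding suslin_def by blast
  define Q where "Q i k = {p :: ('x \<times> 'y) \<times> (nat \<Rightarrow> nat).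
    case i of 0 \<Rightarrow> fst p \<in> cball 0 (real k) | Suc j \<Rightarrow> snd p j \<in> {..k}}" for i k
  obtain L where L: "compact L" "L \<subseteq> R" "a \<le> emeasure \<mu> ((\<lambda>p. fst (fst p)) ` L)"
  proof (rule capacitability[OF sb fin, where \<pi> = "\<lambda>p. fst (fst p)" and R = R and Q = Q and a = a])
    show "continuous_on UNIV (\<lambda>p :: ('x \<times> 'y) \<times> (nat \<Rightarrow> nat). fst (fst p))"
      by (intro continuous_intros)
    show "closed (Q i k)" for i k
    proof (cases i)
      case 0
      have "closed (fst -` cball (0 :: 'x \<times> 'y) (real k) :: (('x \<times> 'y) \<times> (nat \<Rightarrow> nat)) set)"
        by (intro closed_vimage closed_cball continuous_intros)
      then show ?thesis by (simp add: Q_def 0 vimage_def)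
    next
      case (Suc j)
      have "closed ((\<lambda>p :: ('x \<times> 'y) \<times> (nat \<Rightarrow> nat). snd p j) -` {..k})"
        by (intro closed_vimage closed_atMost continuous_on_snd_coordinate)
      then show ?thesis by (simp add: Q_def Suc vimage_def)
    qed
    show "incseq (Q i)" for i
      by (auto simp: incseq_def Q_def split: nat.splits)
    show "(\<Union>k. Q i k) = UNIV" for i
    proof -
      have "\<exists>k. p \<in> Q i k" for p
        by (cases i) (auto simp: Q_def real_arch_simple)
      then show ?thesis by blast
    qed
    show "compact (\<Inter>i. Q i (b i))" for b
    proof -
      have "compactin (product_topology (\<lambda>_. euclidean) UNIV) (PiE UNIV (\<lambda>j. {..b (Suc j)}))"
        unfolding compactin_PiE by (auto intro: finite_imp_compact)
      then have "compact (PiE UNIV (\<lambda>j. {..b (Suc j)}))"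
        by (simp add: euclidean_product_topology)
      then have "compact (cball (0 :: 'x \<times> 'y) (real (b 0)) \<times> (PiE UNIV (\<lambda>j. {..b (Suc j)})))"
        by (intro compact_Times compact_cball)
      moreover have "(\<Inter>i. Q i (b i)) = cball 0 (real (b 0)) \<times> (PiE UNIV (\<lambda>j. {..b (Suc j)}))"
        by (auto simp: Q_def PiE_def Pi_def split: nat.splits)
      ultimately show ?thesis by simp
    qed
    show "a < outer_measure_of \<mu> ((\<lambda>p. fst (fst p)) ` R)"
      using a by (simp add: R(2) image_image)
  qed (use R(1) in auto)
  have "compact (fst ` L)" by (intro compact_continuous_image L(1) continuous_intros)
  then show ?thesis using that[of "fst ` L"] L by (auto simp: R(2) image_image)
qed

text \<open>The Jankov--von Neumann selection theorem up to a null set. Compact subsets of \<open>B\<close> have Borel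
  selections, and by capacitability their projections exhaust the outer measure of
  the projection of \<open>B\<close>. Consequently this projection, which need not be Borel, lies between the Borel set \<open>D\<close>
  and \<open>D \<union> N\<close>, and the selections glue along the first compact set that works.\<close>

theorem borel_measurable_selection:
  fixes B :: "('x::euclidean_space \<times> 'y::euclidean_space) set"
  assumes sb: "sets \<mu> = sets borel" and fin: "finite_measure \<mu>" and B: "B \<in> sets borel"
  obtains \<phi> D N where "\<phi> \<in> borel_measurable borel" "D \<in> sets borel" "N \<in> null_sets \<mu>"
    "D \<subseteq> fst ` B" "fst ` B \<subseteq> D \<union> N" "\<And>x. x \<in> D \<Longrightarrow> (x, \<phi> x) \<in> B"
proof (cases "outer_measure_of \<mu> (fst ` B) = 0")
  case True
  have sp: "space \<mu> = UNIV" using sets_eq_imp_space_eq[OF sb] by simp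
  obtain U where "U \<in> sets \<mu>" "fst ` B \<subseteq> U" "emeasure \<mu> U = 0"
    using outer_measure_of_attain[of "fst ` B" \<mu>] True sp by auto
  then show ?thesis using that[of "\<lambda>_. 0" "{}" U] by (simp add: null_sets_def)
next
  case False
  interpret finite_measure \<mu> by fact
  have sp: "space \<mu> = UNIV" using sets_eq_imp_space_eq[OF sb] by simp
  let ?m = "outer_measure_of \<mu> (fst ` B)"
  obtain a where a: "\<And>n :: nat. a n < ?m" "a \<longlonglongrightarrow> ?m"
    using approx_from_below_dense_linorder[of 0 ?m] False by (metis not_gr_zero)
  have "\<exists>K. compact K \<and> K \<subseteq> B \<and> a n \<le> emeasure \<mu> (fst ` K)" for n
    by (rule suslin_inner_compact[OF sb emeasure_finite[folded infinity_ennreal_def]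
          suslin_borel[OF B] a(1)]) blast
  then obtain K where K: "\<And>n. compact (K n)" "\<And>n. K n \<subseteq> B" "\<And>n. a n \<le> emeasure \<mu> (fst ` K n)"
    by metis
  have "\<exists>\<phi>. \<phi> \<in> borel_measurable borel \<and> (\<forall>x\<in>fst ` K n. (x, \<phi> x) \<in> K n)" for n
    by (rule compact_selection[OF K(1)]) blast
  then obtain \<phi> where \<phi>: "\<And>n. \<phi> n \<in> borel_measurable borel"
    "\<And>n x. x \<in> fst ` K n \<Longrightarrow> (x, \<phi> n x) \<in> K n" by metis
  have meas[measurable]: "fst ` K n \<in> sets borel" for n
    by (intro borel_compact compact_continuous_image K(1) continuous_intros)
  define D where "D = (\<Union>n. fst ` K n)"
  have D: "D \<in> sets borel" unfolding D_def by measurable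
  have D_sub: "D \<subseteq> fst ` B" using K(2) by (auto simp: D_def)
  have "emeasure \<mu> (fst ` K n) \<le> emeasure \<mu> D" for n
    using D sb by (intro emeasure_mono) (auto simp: D_def)
  then have "a n \<le> emeasure \<mu> D" for n
    using K(3)[of n] by (rule order_trans[rotated])
  then have "?m \<le> emeasure \<mu> D" using a(2) by (intro LIMSEQ_le_const2) auto
  moreover obtain U where U: "U \<in> sets \<mu>" "fst ` B \<subseteq> U" "emeasure \<mu> U = ?m"
    using outer_measure_of_attain[of "fst ` B" \<mu>] sp by auto
  ultimately have "emeasure \<mu> (U - D) = 0"
    using D D_sub sb emeasure_Diff[of \<mu> D U] emeasure_mono[of D U \<mu>]
    by (auto simp: diff_eq_0_iff_ennreal less_top[symmetric])
  then have null: "U - D \<in> null_sets \<mu>" using U D sb by (auto simp: null_sets_def)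
  define idx where "idx x = (LEAST n. x \<in> fst ` K n)" for x
  have idx[measurable]: "idx \<in> borel \<rightarrow>\<^sub>M count_space UNIV"
    unfolding idx_def by (intro measurable_Least) measurable
  have "(\<lambda>x. \<phi> (idx x) x) \<in> borel_measurable borel"
    by (rule measurable_compose_countable[OF \<phi>(1) idx])
  moreover have "(x, \<phi> (idx x) x) \<in> B" if "x \<in> D" for x
  proof -
    have "x \<in> fst ` K (idx x)" unfolding idx_def by (rule LeastI_ex) (use that in \<open>auto simp: D_def\<close>)
    then show ?thesis using \<phi>(2) K(2) by blast
  qed
  ultimately show ?thesis using that[OF _ D null D_sub] U(2) by blast
qed

section \<open>Conditional essential bounds\<close>

text \<open>Exhaustion: a countable subfamily whose union has the largest possible probability absorbs every
  further member up to a null set.\<close>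

lemma (in prob_space) essential_union:
  assumes "\<A> \<noteq> {}" "\<A> \<subseteq> events"
  obtains A :: "nat \<Rightarrow> 'a set" where "\<And>n. A n \<in> \<A>" "\<And>B. B \<in> \<A> \<Longrightarrow> B - (\<Union>n. A n) \<in> null_sets M"
proof -
  define J where "J = {A :: nat \<Rightarrow> 'a set. range A \<subseteq> \<A>}"
  obtain A0 where "A0 \<in> \<A>" using assms(1) by blast
  then have "(\<lambda>_. A0) \<in> J" by (auto simp: J_def)
  then have ne: "J \<noteq> {}" by blast
  let ?u = "\<lambda>A :: nat \<Rightarrow> 'a set. \<Union>n. A n"
  define s where "s = (SUP A\<in>J. prob (?u A))"
  have bdd: "bdd_above ((\<lambda>A. prob (?u A)) ` J)" by (intro bdd_aboveI[of _ 1]) auto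
  have ev: "?u A \<in> events" if "A \<in> J" for A
    using that assms(2) by (intro sets.countable_UN) (auto simp: J_def)
  have le: "prob (?u A) \<le> s" if "A \<in> J" for A
    unfolding s_def by (rule cSUP_upper[OF that bdd])
  \<comment> \<open>The supremum is attained, because near-optimal sequences can be merged into a single one.\<close>
  have "\<exists>A\<in>J. s - 1 / Suc k < prob (?u A)" for k
    using less_cSUP_iff[OF ne bdd, of "s - 1 / Suc k"] by (simp add: s_def)
  then obtain A where A: "\<And>k. A k \<in> J" "\<And>k. s - 1 / Suc k < prob (?u (A k))" by metis
  define U where "U j = (case prod_decode j of (k, n) \<Rightarrow> A k n)" for j
  have UJ: "U \<in> J" using A(1) unfolding J_def U_def by (force split: prod.split)
  have sub: "?u (A k) \<subseteq> ?u U" for k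
  proof
    fix x assume "x \<in> ?u (A k)"
    then obtain n where "x \<in> A k n" by blast
    then have "x \<in> U (prod_encode (k, n))" by (simp add: U_def)
    then show "x \<in> ?u U" by blast
  qed
  have "s - 1 / Suc k < prob (?u U)" for k
    by (rule less_le_trans[OF A(2) finite_measure_mono[OF sub ev[OF UJ]]])
  then have "s \<le> prob (?u U) + 1 / Suc k" for k by (simp add: less_imp_le algebra_simps)
  moreover have "(\<lambda>k. prob (?u U) + 1 / Suc k) \<longlonglongrightarrow> prob (?u U) + 0"
    by (intro tendsto_add tendsto_const LIMSEQ_Suc lim_1_over_n)
  ultimately have s: "s \<le> prob (?u U)"
    using LIMSEQ_le_const[of "\<lambda>k. prob (?u U) + 1 / Suc k" "prob (?u U)" s] by simp
  have "B - ?u U \<in> null_sets M" if B: "B \<in> \<A>" for B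
  proof -
    have J: "case_nat B U \<in> J" using B UJ unfolding J_def by (force split: nat.splits)
    have eq: "?u (case_nat B U) = B \<union> ?u U"
      by (subst UNIV_nat_eq) auto
    have "prob (B \<union> ?u U) \<le> prob (?u U)" using le[OF J] s eq by simp
    moreover have B_ev: "B \<in> events" using B assms(2) by blast
    have "prob ((B - ?u U) \<union> ?u U) = prob (B - ?u U) + prob (?u U)"
      by (intro finite_measure_Union sets.Diff B_ev ev UJ) blast
    ultimately have "prob (B - ?u U) \<le> 0" by (simp only: Un_Diff_cancel2)
    then show ?thesis using sets.Diff[OF B_ev ev[OF UJ]]
      by (simp add: null_sets_def emeasure_eq_measure measure_le_0_iff)
  qed
  moreover have "U n \<in> \<A>" for n using UJ by (auto simp: J_def)
  ultimately show ?thesis using that by blast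
qed

text \<open>A sub-\<open>\<sigma>\<close>-algebra that contains all null sets; completeness is what turns selections and projections up to
  a null set into measurable ones.\<close>

locale complete_subalgebra = prob_space M for M :: "'a measure" +
  fixes N :: "'a measure"
  assumes subalg: "subalgebra M N"
    and complete: "\<And>A Z. Z \<in> null_sets M \<Longrightarrow> A \<subseteq> Z \<Longrightarrow> A \<in> sets N"
begin

lemma space_N [simp]: "space N = space M" and sets_N: "A \<in> sets N \<Longrightarrow> A \<in> events"
  using subalg by (auto simp: subalgebra_def)

lemma measurable_N: "f \<in> measurable N L \<Longrightarrow> f \<in> measurable M L"
  by (rule measurable_from_subalg[OF subalg])

text \<open>The selection theorem for the law of \<open>h\<close>, transported back along \<open>h\<close>.\<close>

lemma
  fixes h :: "'a \<Rightarrow> 'x::euclidean_space" and B :: "('x \<times> 'y::euclidean_space) set"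
  assumes h: "h \<in> borel_measurable N" and B: "B \<in> sets borel"
  shows measurable_projection: "{\<omega> \<in> space M. h \<omega> \<in> fst ` B} \<in> sets N"
    and measurable_selection:
      "\<exists>W \<in> borel_measurable N. AE \<omega> in M. h \<omega> \<in> fst ` B \<longrightarrow> (h \<omega>, W \<omega>) \<in> B"
proof -
  note [measurable] = h measurable_N[OF h]
  interpret D: prob_space "distr M borel h" by (rule prob_space_distr) measurable
  obtain \<phi> D Z where \<phi>: "\<phi> \<in> borel_measurable borel" and D: "D \<in> sets borel"
    and Z: "Z \<in> null_sets (distr M borel h)" and D_sub: "D \<subseteq> fst ` B" and B_sub: "fst ` B \<subseteq> D \<union> Z"
    and sel: "\<And>x. x \<in> D \<Longrightarrow> (x, \<phi> x) \<in> B"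
    by (rule borel_measurable_selection[OF _ D.finite_measure_axioms B]) auto
  have null: "h -` Z \<inter> space M \<in> null_sets M"
    using Z by (auto simp: null_sets_distr_iff)
  have "{\<omega> \<in> space M. h \<omega> \<in> fst ` B} =
      (h -` D \<inter> space N) \<union> {\<omega> \<in> h -` Z \<inter> space M. h \<omega> \<in> fst ` B}"
    using D_sub B_sub by auto
  also have "\<dots> \<in> sets N"
    by (intro sets.Un measurable_sets[OF h D] complete[OF null]) blast
  finally show "{\<omega> \<in> space M. h \<omega> \<in> fst ` B} \<in> sets N" .
  have "AE \<omega> in M. \<omega> \<notin> h -` Z \<inter> space M" by (rule AE_not_in[OF null])
  with AE_space have "AE \<omega> in M. h \<omega> \<in> fst ` B \<longrightarrow> (h \<omega>, \<phi> (h \<omega>)) \<in> B"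
  proof eventually_elim
    case (elim \<omega>)
    show ?case
    proof
      assume "h \<omega> \<in> fst ` B"
      then have "h \<omega> \<in> D" using B_sub elim by blast
      then show "(h \<omega>, \<phi> (h \<omega>)) \<in> B" by (rule sel)
    qed
  qed
  moreover have "(\<lambda>\<omega>. \<phi> (h \<omega>)) \<in> borel_measurable N"
    by (rule measurable_compose[OF h \<phi>])
  ultimately show "\<exists>W \<in> borel_measurable N. AE \<omega> in M. h \<omega> \<in> fst ` B \<longrightarrow> (h \<omega>, W \<omega>) \<in> B"
    by (rule bexI)
qed

text \<open>The essential infimum of a family is an infimum of countably many members: for each rational \<open>q\<close>
  take countably many members that essentially exhaust the event of some member being below \<open>q\<close>.\<close>

lemma ess_inf_sequence:
  fixes \<X> :: "('a \<Rightarrow> ereal) set"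
  assumes ne: "\<X> \<noteq> {}" and meas: "\<X> \<subseteq> borel_measurable N"
  obtains X :: "nat \<Rightarrow> 'a \<Rightarrow> ereal" where "\<And>n. X n \<in> \<X>"
    "\<And>Y. Y \<in> \<X> \<Longrightarrow> AE \<omega> in M. (INF n. X n \<omega>) \<le> Y \<omega>"
proof -
  let ?below = "\<lambda>(q :: rat) X. {\<omega> \<in> space M. X \<omega> < ereal (of_rat q)}"
  have ev: "?below q X \<in> events" if "X \<in> \<X>" for q X
  proof -
    have [measurable]: "X \<in> borel_measurable M" using that meas by (intro measurable_N) blast
    show ?thesis by measurable
  qed
  have "\<exists>X :: nat \<Rightarrow> 'a \<Rightarrow> ereal. (\<forall>n. X n \<in> \<X>) \<and>
      (\<forall>Y\<in>\<X>. ?below q Y - (\<Union>n. ?below q (X n)) \<in> null_sets M)" for q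
  proof -
    obtain A :: "nat \<Rightarrow> 'a set" where A: "\<And>n. A n \<in> ?below q ` \<X>"
      "\<And>B. B \<in> ?below q ` \<X> \<Longrightarrow> B - (\<Union>n. A n) \<in> null_sets M"
    proof (rule essential_union)
      show "?below q ` \<X> \<noteq> {}" using ne by blast
      show "?below q ` \<X> \<subseteq> events" using ev by blast
    qed blast
    have "\<exists>X. X \<in> \<X> \<and> A n = ?below q X" for n using A(1)[of n] by blast
    then have "\<exists>X. \<forall>n. X n \<in> \<X> \<and> A n = ?below q (X n)" by (intro choice) blast
    then obtain X where X: "\<And>n. X n \<in> \<X>" "\<And>n. A n = ?below q (X n)" by blast
    show ?thesis using A(2)[OF imageI] X by (intro exI[of _ X]) simp
  qed
  then have "\<exists>X :: rat \<Rightarrow> nat \<Rightarrow> 'a \<Rightarrow> ereal. \<forall>q. (\<forall>n. X q n \<in> \<X>) \<and>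
      (\<forall>Y\<in>\<X>. ?below q Y - (\<Union>n. ?below q (X q n)) \<in> null_sets M)"
    by (intro choice) blast
  then obtain X :: "rat \<Rightarrow> nat \<Rightarrow> 'a \<Rightarrow> ereal" where X: "\<And>q n. X q n \<in> \<X>"
    "\<And>q Y. Y \<in> \<X> \<Longrightarrow> ?below q Y - (\<Union>n. ?below q (X q n)) \<in> null_sets M" by blast
  define Z where "Z j = (case prod_decode j of (i, n) \<Rightarrow> X (from_nat i) n)" for j
  have Z: "Z (prod_encode (to_nat q, n)) = X q n" for q n by (simp add: Z_def)
  have "AE \<omega> in M. (INF n. Z n \<omega>) \<le> Y \<omega>" if Y: "Y \<in> \<X>" for Y
  proof -
    have "AE \<omega> in M. \<forall>q. \<omega> \<notin> ?below q Y - (\<Union>n. ?below q (X q n))"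
      unfolding AE_all_countable by (intro allI AE_not_in X(2) Y)
    with AE_space show ?thesis
    proof eventually_elim
      case (elim \<omega>)
      show ?case
      proof (rule ccontr)
        assume "\<not> (INF n. Z n \<omega>) \<le> Y \<omega>"
        then have "Y \<omega> < (INF n. Z n \<omega>)" by (simp only: not_le)
        then obtain q where q: "Y \<omega> < ereal (of_rat q)" "ereal (of_rat q) < (INF n. Z n \<omega>)"
          using ereal_dense3 by blast
        then obtain n where "X q n \<omega> < ereal (of_rat q)" using elim by blast
        moreover have "(INF n. Z n \<omega>) \<le> X q n \<omega>"
          using INF_lower[of "prod_encode (to_nat q, n)" UNIV "\<lambda>n. Z n \<omega>"] by (simp add: Z)
        ultimately show False using q(2) by simp
      qed
    qed
  qed
  moreover have "Z n \<in> \<X>" for n by (simp add: Z_def X(1) split: prod.split)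
  ultimately show ?thesis using that by blast
qed

text \<open>Since an essential infimum exists, the version picked by choice has the defining properties.\<close>

lemma cond_ess_inf:
  fixes \<X> :: "('a \<Rightarrow> ereal) set"
  assumes ne: "\<X> \<noteq> {}" and meas: "\<X> \<subseteq> borel_measurable N"
  shows cond_ess_inf_measurable: "cond_ess_inf M N \<X> \<in> borel_measurable N"
    and cond_ess_inf_lower: "\<And>X. X \<in> \<X> \<Longrightarrow> AE \<omega> in M. cond_ess_inf M N \<X> \<omega> \<le> X \<omega>"
    and cond_ess_inf_greatest: "\<And>Z. Z \<in> borel_measurable N \<Longrightarrow>
      (\<And>X. X \<in> \<X> \<Longrightarrow> AE \<omega> in M. Z \<omega> \<le> X \<omega>) \<Longrightarrow> AE \<omega> in M. Z \<omega> \<le> cond_ess_inf M N \<X> \<omega>"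
    and cond_ess_inf_sequence: "\<exists>X :: nat \<Rightarrow> 'a \<Rightarrow> ereal. (\<forall>n. X n \<in> \<X>) \<and>
      (AE \<omega> in M. (INF n. X n \<omega>) \<le> cond_ess_inf M N \<X> \<omega>)"
proof -
  obtain X :: "nat \<Rightarrow> 'a \<Rightarrow> ereal" where X: "\<And>n. X n \<in> \<X>"
    "\<And>Y. Y \<in> \<X> \<Longrightarrow> AE \<omega> in M. (INF n. X n \<omega>) \<le> Y \<omega>"
    by (rule ess_inf_sequence[OF ne meas]) blast
  have low: "ess_lower_bound M N \<X> (\<lambda>\<omega>. INF n. X n \<omega>)"
    unfolding ess_lower_bound_def
    using X meas by (auto intro!: borel_measurable_INF)
  have great: "AE \<omega> in M. Z' \<omega> \<le> (INF n. X n \<omega>)" if "ess_lower_bound M N \<X> Z'" for Z'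
  proof -
    have "AE \<omega> in M. \<forall>n. Z' \<omega> \<le> X n \<omega>"
      unfolding AE_all_countable using that X(1) by (auto simp: ess_lower_bound_def)
    then show ?thesis by eventually_elim (auto intro: INF_greatest)
  qed
  have spec: "ess_lower_bound M N \<X> (cond_ess_inf M N \<X>) \<and>
    (\<forall>Z'. ess_lower_bound M N \<X> Z' \<longrightarrow> (AE \<omega> in M. Z' \<omega> \<le> cond_ess_inf M N \<X> \<omega>))"
    unfolding cond_ess_inf_def by (rule someI[of _ "\<lambda>\<omega>. INF n. X n \<omega>"]) (use low great in blast)
  then show "cond_ess_inf M N \<X> \<in> borel_measurable N"
    and "\<And>X. X \<in> \<X> \<Longrightarrow> AE \<omega> in M. cond_ess_inf M N \<X> \<omega> \<le> X \<omega>"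
    by (auto simp: ess_lower_bound_def)
  show "AE \<omega> in M. Z \<omega> \<le> cond_ess_inf M N \<X> \<omega>"
    if "Z \<in> borel_measurable N" "\<And>X. X \<in> \<X> \<Longrightarrow> AE \<omega> in M. Z \<omega> \<le> X \<omega>" for Z
    using spec that by (auto simp: ess_lower_bound_def)
  show "\<exists>X :: nat \<Rightarrow> 'a \<Rightarrow> ereal. (\<forall>n. X n \<in> \<X>) \<and>
      (AE \<omega> in M. (INF n. X n \<omega>) \<le> cond_ess_inf M N \<X> \<omega>)"
    using X(1) spec low by (intro exI[of _ X]) auto
qed

text \<open>The conditional essential supremum of \<open>X\<close> is the essential infimum of its measurable upper bounds.\<close>

lemma
  fixes X :: "'a \<Rightarrow> ereal"
  shows cond_ess_sup_measurable: "cond_ess_sup M N {X} \<in> borel_measurable N"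
    and cond_ess_sup_upper: "AE \<omega> in M. X \<omega> \<le> cond_ess_sup M N {X} \<omega>"
    and cond_ess_sup_least: "\<And>Z. Z \<in> borel_measurable N \<Longrightarrow> AE \<omega> in M. X \<omega> \<le> Z \<omega> \<Longrightarrow>
      AE \<omega> in M. cond_ess_sup M N {X} \<omega> \<le> Z \<omega>"
proof -
  define \<U> where "\<U> = {Z. ess_upper_bound M N {X} Z}"
  have "(\<lambda>_. \<infinity>) \<in> \<U>" by (simp add: \<U>_def ess_upper_bound_def)
  then have ne: "\<U> \<noteq> {}" by blast
  have meas: "\<U> \<subseteq> borel_measurable N" by (auto simp: \<U>_def ess_upper_bound_def)
  obtain Z :: "nat \<Rightarrow> 'a \<Rightarrow> ereal" where Z: "\<And>n. Z n \<in> \<U>"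
    "\<And>Y. Y \<in> \<U> \<Longrightarrow> AE \<omega> in M. (INF n. Z n \<omega>) \<le> Y \<omega>"
    by (rule ess_inf_sequence[OF ne meas]) blast
  have "AE \<omega> in M. \<forall>n. X \<omega> \<le> Z n \<omega>"
    unfolding AE_all_countable using Z(1) by (auto simp: \<U>_def ess_upper_bound_def)
  then have "AE \<omega> in M. X \<omega> \<le> (INF n. Z n \<omega>)"
    by eventually_elim (auto intro: INF_greatest)
  then have up: "ess_upper_bound M N {X} (\<lambda>\<omega>. INF n. Z n \<omega>)"
    unfolding ess_upper_bound_def using Z(1) meas by (auto intro!: borel_measurable_INF)
  have spec: "ess_upper_bound M N {X} (cond_ess_sup M N {X}) \<and>
    (\<forall>Z'. ess_upper_bound M N {X} Z' \<longrightarrow> (AE \<omega> in M. cond_ess_sup M N {X} \<omega> \<le> Z' \<omega>))"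
    unfolding cond_ess_sup_def
    by (rule someI[of _ "\<lambda>\<omega>. INF n. Z n \<omega>"]) (use up Z(2) in \<open>auto simp: \<U>_def\<close>)
  then show "cond_ess_sup M N {X} \<in> borel_measurable N"
    and "AE \<omega> in M. X \<omega> \<le> cond_ess_sup M N {X} \<omega>"
    by (auto simp: ess_upper_bound_def)
  show "AE \<omega> in M. cond_ess_sup M N {X} \<omega> \<le> Z \<omega>"
    if "Z \<in> borel_measurable N" "AE \<omega> in M. X \<omega> \<le> Z \<omega>" for Z
    using spec that by (auto simp: ess_upper_bound_def)
qed

end

section \<open>The worst case over the conditional support\<close>

lemma lsc_borel_measurable:
  fixes f :: "'x::topological_space \<Rightarrow> ereal"
  assumes "lsc f"
  shows "f \<in> borel_measurable borel"
  using assms by (intro borel_measurableI_le) (auto simp: lsc_def)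

lemma lsc_section:
  fixes g :: "'x::topological_space \<Rightarrow> 'v::topological_space \<Rightarrow> ereal"
  assumes "lsc (\<lambda>(s, v). g s v)"
  shows "closed {s. g s v \<le> r}"
proof -
  have "closed ((\<lambda>s. (s, v)) -` {p. (case p of (s, v) \<Rightarrow> g s v) \<le> r})"
    using assms by (intro closed_vimage continuous_intros) (auto simp: lsc_def)
  then show ?thesis by (simp add: vimage_def)
qed

context complete_subalgebra
begin

text \<open>A lower semicontinuous function has the same supremum over a set and over its closure.\<close>

lemma cond_support_dominates:
  fixes g :: "'x::topological_space \<Rightarrow> 'v::topological_space \<Rightarrow> ereal" and a :: "nat \<Rightarrow> 'a \<Rightarrow> 'x"
  assumes lsc: "lsc (\<lambda>(s, v). g s v)"
    and supp: "is_cond_support M N Y (\<lambda>\<omega>. closure {a k \<omega> | k. k \<ge> 1})"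
  shows "AE \<omega> in M. g (Y \<omega>) (V \<omega>) \<le> (SUP k\<in>{1..}. g (a k \<omega>) (V \<omega>))"
proof -
  have "AE \<omega> in M. Y \<omega> \<in> closure {a k \<omega> | k. k \<ge> 1}"
    using supp by (simp add: is_cond_support_def)
  then show ?thesis
  proof eventually_elim
    case (elim \<omega>)
    let ?L = "{s. g s (V \<omega>) \<le> (SUP k\<in>{1..}. g (a k \<omega>) (V \<omega>))}"
    have "{a k \<omega> | k. k \<ge> 1} \<subseteq> ?L"
      by (auto intro!: SUP_upper2)
    then have "closure {a k \<omega> | k. k \<ge> 1} \<subseteq> ?L"
      by (intro closure_minimal lsc_section[OF lsc])
    then show ?case using elim by blast
  qed
qed

text \<open>If \<open>Z\<close> bounds \<open>g Y V\<close>, then for each level \<open>q\<close> the random set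
  \<open>{s. g s V \<le> q}\<close>, enlarged to the whole space where \<open>Z > q\<close>, is closed and contains \<open>Y\<close>. By minimality it
  contains the conditional support and hence all \<open>a k\<close>.\<close>

lemma cond_support_least:
  fixes g :: "'x::euclidean_space \<Rightarrow> 'v::euclidean_space \<Rightarrow> ereal" and a :: "nat \<Rightarrow> 'a \<Rightarrow> 'x"
  assumes lsc: "lsc (\<lambda>(s, v). g s v)"
    and supp: "is_cond_support M N Y (\<lambda>\<omega>. closure {a k \<omega> | k. k \<ge> 1})"
    and V: "V \<in> borel_measurable N" and Z: "Z \<in> borel_measurable N"
    and le: "AE \<omega> in M. g (Y \<omega>) (V \<omega>) \<le> Z \<omega>"
  shows "AE \<omega> in M. (SUP k\<in>{1..}. g (a k \<omega>) (V \<omega>)) \<le> Z \<omega>"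
proof -
  note [measurable] = V Z
  have inside: "AE \<omega> in M. \<forall>k\<ge>1. Z \<omega> \<le> ereal q \<longrightarrow> g (a k \<omega>) (V \<omega>) \<le> ereal q" for q :: real
  proof -
    define \<Gamma> where "\<Gamma> \<omega> = (if Z \<omega> \<le> ereal q then {s. g s (V \<omega>) \<le> ereal q} else UNIV)" for \<omega>
    have "random_closed_set N \<Gamma>"
      unfolding random_closed_set_def
    proof (intro conjI ballI allI impI)
      show "closed (\<Gamma> \<omega>)" for \<omega> using lsc_section[OF lsc] by (simp add: \<Gamma>_def)
      fix U :: "'x set" assume U: "open U"
      \<comment> \<open>The set-valued map \<open>\<Gamma>\<close> is measurable because projecting a closed set along a compact one
        gives a closed set, and open sets are countable unions of compact ones.\<close>
      obtain K :: "nat \<Rightarrow> 'x set" where K: "\<And>n. compact (K n)" "(\<Union>n. K n) = U"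
        by (rule open_Union_compact_subsets[OF U]) blast
      let ?T = "{p. (case p of (s, v) \<Rightarrow> g s v) \<le> ereal q}"
      have "closed {v. \<exists>s. s \<in> K n \<and> (s, v) \<in> ?T}" for n
        using lsc by (intro closed_compact_projection K(1)) (simp add: lsc_def)
      then have "(\<Union>n. {v. \<exists>s. s \<in> K n \<and> (s, v) \<in> ?T}) \<in> sets borel"
        by (intro sets.countable_UN) auto
      also have "(\<Union>n. {v. \<exists>s. s \<in> K n \<and> (s, v) \<in> ?T}) = {v. \<exists>s\<in>U. g s v \<le> ereal q}"
        using K(2) by auto
      finally have "V -` {v. \<exists>s\<in>U. g s v \<le> ereal q} \<inter> space N \<in> sets N"
        by (rule measurable_sets[OF V])
      moreover have "{\<omega> \<in> space N. Z \<omega> \<le> ereal q} \<in> sets N" "{\<omega> \<in> space N. ereal q < Z \<omega>} \<in> sets N"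
        by measurable
      moreover have "{\<omega> \<in> space N. \<Gamma> \<omega> \<inter> U \<noteq> {}} =
          ({\<omega> \<in> space N. Z \<omega> \<le> ereal q} \<inter> (V -` {v. \<exists>s\<in>U. g s v \<le> ereal q} \<inter> space N)) \<union>
          (if U = {} then {} else {\<omega> \<in> space N. ereal q < Z \<omega>})"
        by (auto simp: \<Gamma>_def not_le split: if_splits)
      ultimately show "{\<omega> \<in> space N. \<Gamma> \<omega> \<inter> U \<noteq> {}} \<in> sets N"
        by (auto intro!: sets.Un sets.Int)
    qed
    moreover have "AE \<omega> in M. Y \<omega> \<in> \<Gamma> \<omega>"
      using le by eventually_elim (auto simp: \<Gamma>_def)
    ultimately have "AE \<omega> in M. closure {a k \<omega> | k. k \<ge> 1} \<subseteq> \<Gamma> \<omega>"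
      using supp by (simp add: is_cond_support_def)
    then show ?thesis
    proof eventually_elim
      case (elim \<omega>)
      have "a k \<omega> \<in> \<Gamma> \<omega>" if "k \<ge> 1" for k
      proof -
        have "a k \<omega> \<in> closure {a k \<omega> | k. k \<ge> 1}"
          by (rule subsetD[OF closure_subset]) (use that in blast)
        then show ?thesis using elim by (rule subsetD[rotated])
      qed
      then show ?case by (auto simp: \<Gamma>_def split: if_splits)
    qed
  qed
  have "AE \<omega> in M. \<forall>q::rat. \<forall>k\<ge>1. Z \<omega> \<le> ereal (of_rat q) \<longrightarrow> g (a k \<omega>) (V \<omega>) \<le> ereal (of_rat q)"
    by (subst AE_all_countable) (intro allI inside)
  then show ?thesis
  proof eventually_elim
    case (elim \<omega>)
    have "g (a k \<omega>) (V \<omega>) \<le> Z \<omega>" if k: "k \<ge> 1" for k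
    proof (rule ccontr)
      assume "\<not> ?thesis"
      then have "Z \<omega> < g (a k \<omega>) (V \<omega>)" by (simp only: not_le)
      then obtain q where "Z \<omega> < ereal (of_rat q)" "ereal (of_rat q) < g (a k \<omega>) (V \<omega>)"
        using ereal_dense3 by blast
      then show False using elim k by (meson leD less_imp_le)
    qed
    then show ?case by (intro SUP_least) simp
  qed
qed

text \<open>Conditionally on the past, \<open>Y\<close> takes the value \<open>a k\<close> with positive probability, so an event of the past on
  which \<open>g (a k) V\<close> exceeds \<open>Z\<close> would, when intersected with \<open>Y = a k\<close>, violate the bound \<open>Z\<close>.\<close>

lemma cond_atoms_least:
  fixes g :: "'x::euclidean_space \<Rightarrow> 'v::euclidean_space \<Rightarrow> ereal" and a :: "nat \<Rightarrow> 'a \<Rightarrow> 'x"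
  assumes g: "(\<lambda>(s, v). g s v) \<in> borel_measurable borel"
    and Y: "Y \<in> borel_measurable M" and a: "\<And>k. k \<ge> 1 \<Longrightarrow> a k \<in> borel_measurable N"
    and pos: "\<And>k. k \<ge> 1 \<Longrightarrow>
      AE \<omega> in M. real_cond_exp M N (indicator {\<omega>\<in>space M. Y \<omega> = a k \<omega>}) \<omega> > 0"
    and V: "V \<in> borel_measurable N" and Z: "Z \<in> borel_measurable N"
    and le: "AE \<omega> in M. g (Y \<omega>) (V \<omega>) \<le> Z \<omega>"
  shows "AE \<omega> in M. (SUP k\<in>{1..}. g (a k \<omega>) (V \<omega>)) \<le> Z \<omega>"
proof -
  interpret finite_measure_subalgebra M N by unfold_locales (rule subalg)
  note [measurable] = V Z Y measurable_N[OF V] measurable_N[OF Z]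
  have each: "AE \<omega> in M. g (a k \<omega>) (V \<omega>) \<le> Z \<omega>" if k: "k \<ge> 1" for k
  proof -
    note [measurable] = a[OF k] measurable_N[OF a[OF k]]
    let ?E = "{\<omega>\<in>space M. Y \<omega> = a k \<omega>}"
    have E: "?E \<in> events" by measurable
    have gm: "(\<lambda>\<omega>. g (a k \<omega>) (V \<omega>)) \<in> borel_measurable N"
      using measurable_compose[OF _ g, of "\<lambda>\<omega>. (a k \<omega>, V \<omega>)" N] by (simp add: borel_prod[symmetric])
    define D where "D = {\<omega> \<in> space N. Z \<omega> < g (a k \<omega>) (V \<omega>)}"
    have D: "D \<in> sets N" unfolding D_def using gm by measurable
    note D_M = sets_N[OF D]
    have int: "integrable M (indicator ?E :: 'a \<Rightarrow> real)"
      using E by (simp add: integrable_indicator_iff less_top[symmetric])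
    have "AE \<omega> in M. indicator D \<omega> * indicator ?E \<omega> = (0 :: real)"
      using le by eventually_elim (auto simp: D_def indicator_def)
    then have "(\<integral>\<omega>\<in>D. indicator ?E \<omega> \<partial>M) = (0 :: real)"
      unfolding set_lebesgue_integral_def real_scaleR_def by (subst integral_cong_AE[where g = "\<lambda>_. 0"]) (use D_M E in auto)
    then have "(\<integral>\<omega>. indicator D \<omega> * real_cond_exp M N (indicator ?E) \<omega> \<partial>M) = 0"
      using real_cond_exp_intA[OF int D] by (simp add: set_lebesgue_integral_def)
    moreover have "integrable M (\<lambda>\<omega>. indicator D \<omega> * real_cond_exp M N (indicator ?E) \<omega>)"
      using integrable_real_mult_indicator[OF D_M real_cond_exp_int(1)[OF int]] by (simp add: mult.commute)
    moreover have "AE \<omega> in M. 0 \<le> indicator D \<omega> * real_cond_exp M N (indicator ?E) \<omega>"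
      using pos[OF k] by eventually_elim (simp add: indicator_def)
    ultimately have "AE \<omega> in M. indicator D \<omega> * real_cond_exp M N (indicator ?E) \<omega> = 0"
      using integral_nonneg_eq_0_iff_AE by blast
    with pos[OF k] AE_space show ?thesis
      by eventually_elim (auto simp: D_def indicator_def split: if_splits)
  qed
  have "AE \<omega> in M. \<forall>k. k \<ge> 1 \<longrightarrow> g (a k \<omega>) (V \<omega>) \<le> Z \<omega>"
    unfolding AE_all_countable by (intro allI AE_impI each)
  then show ?thesis by eventually_elim (auto intro: SUP_least)
qed

end

section \<open>Convex extended real functions\<close>

lemma ext_convexD:
  assumes "ext_convex p" "p x \<le> ereal a" "p y \<le> ereal b" "0 \<le> u" "0 \<le> w" "u + w = 1"
  shows "p (u *\<^sub>R x + w *\<^sub>R y) \<le> ereal (u * a + w * b)"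
proof -
  have "u *\<^sub>R (x, a) + w *\<^sub>R (y, b) \<in> {(x, r). p x \<le> ereal r}"
    using assms unfolding ext_convex_def by (intro convexD) auto
  then show ?thesis by simp
qed

lemma ext_convexI:
  assumes "\<And>x y a b u w. p x \<le> ereal a \<Longrightarrow> p y \<le> ereal b \<Longrightarrow> 0 \<le> u \<Longrightarrow> 0 \<le> w \<Longrightarrow> u + w = 1 \<Longrightarrow>
    p (u *\<^sub>R x + w *\<^sub>R y) \<le> ereal (u * a + w * b)"
  shows "ext_convex p"
  unfolding ext_convex_def by (rule convexI) (auto intro: assms)

lemma ext_convex_SUP:
  assumes "\<And>k. k \<in> K \<Longrightarrow> ext_convex (f k)"
  shows "ext_convex (\<lambda>x. SUP k\<in>K. f k x)"
proof -
  have "{(x, r). (SUP k\<in>K. f k x) \<le> ereal r} = (\<Inter>k\<in>K. {(x, r). f k x \<le> ereal r})"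
    by (auto simp: SUP_le_iff)
  then show ?thesis using assms by (simp add: ext_convex_def convex_INT)
qed

text \<open>Convexity passes through the partial infimum because near-optimal \<open>y1\<close> and \<open>y2\<close> for the
  two endpoints can be combined; the infimum need not be attained, whence the error \<open>e\<close>.\<close>

lemma ext_convex_infimal_convolution:
  assumes K: "convex_on UNIV K" and L: "linear L" and f: "ext_convex f"
  shows "ext_convex (\<lambda>v. INF y. ereal (K (L (y - v))) + f y)"
proof (rule ext_convexI)
  fix v1 v2 a b and u w :: real
  assume le: "(INF y. ereal (K (L (y - v1))) + f y) \<le> ereal a"
    "(INF y. ereal (K (L (y - v2))) + f y) \<le> ereal b"
    and uw: "0 \<le> u" "0 \<le> w" "u + w = 1"
  define v where "v = u *\<^sub>R v1 + w *\<^sub>R v2"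
  have "(INF y. ereal (K (L (y - v))) + f y) \<le> ereal (u * a + w * b) + ereal e" if "e > 0" for e
  proof -
    have "(INF y. ereal (K (L (y - v1))) + f y) < ereal (a + e)"
      "(INF y. ereal (K (L (y - v2))) + f y) < ereal (b + e)"
      using le that by (auto elim!: le_less_trans)
    then obtain y1 y2 where y: "ereal (K (L (y1 - v1))) + f y1 < ereal (a + e)"
      "ereal (K (L (y2 - v2))) + f y2 < ereal (b + e)" by (auto simp: INF_less_iff)
    have shift: "x \<le> ereal (q - p)" if "ereal p + x < ereal q" for x p q
      using that by (cases x) auto
    have fy: "f (u *\<^sub>R y1 + w *\<^sub>R y2) \<le> ereal (u * (a + e - K (L (y1 - v1))) + w * (b + e - K (L (y2 - v2))))"
      by (intro ext_convexD[OF f] shift y uw)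
    have "L ((u *\<^sub>R y1 + w *\<^sub>R y2) - v) = u *\<^sub>R L (y1 - v1) + w *\<^sub>R L (y2 - v2)"
      unfolding linear_scale[OF L, symmetric] linear_add[OF L, symmetric] v_def
      by (simp add: algebra_simps)
    then have Ky: "K (L ((u *\<^sub>R y1 + w *\<^sub>R y2) - v)) \<le> u * K (L (y1 - v1)) + w * K (L (y2 - v2))"
      using K uw by (simp add: convex_on_def)
    have "(INF y. ereal (K (L (y - v))) + f y) \<le>
        ereal (K (L ((u *\<^sub>R y1 + w *\<^sub>R y2) - v))) + f (u *\<^sub>R y1 + w *\<^sub>R y2)"
      by (rule INF_lower) simp
    also have "\<dots> \<le> ereal (u * K (L (y1 - v1)) + w * K (L (y2 - v2))) +
        ereal (u * (a + e - K (L (y1 - v1))) + w * (b + e - K (L (y2 - v2))))"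
      by (intro add_mono fy) (simp add: Ky)
    also have "\<dots> = ereal (u * a + w * b + (u + w) * e)" by (simp add: algebra_simps)
    also have "\<dots> = ereal (u * a + w * b) + ereal e" by (simp add: uw)
    finally show ?thesis .
  qed
  then show "(INF y. ereal (K (L (y - (u *\<^sub>R v1 + w *\<^sub>R v2)))) + f y) \<le> ereal (u * a + w * b)"
    unfolding v_def by (rule ereal_le_epsilon2[rule_format])
qed

text \<open>A convex function below \<open>\<infinity>\<close> that takes the value \<open>-\<infinity>\<close> is constant; otherwise it is
  real-valued, and real convex functions on Euclidean space are continuous.\<close>

lemma ext_convex_continuous:
  fixes p :: "'v::euclidean_space \<Rightarrow> ereal"
  assumes p: "ext_convex p" and fin: "\<And>v. p v < \<infinity>"
  shows "continuous_on UNIV p"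
proof (cases "\<exists>x. p x = -\<infinity>")
  case True
  then obtain x where x: "p x = -\<infinity>" by blast
  have "p y = -\<infinity>" for y
  proof -
    obtain b where b: "p (2 *\<^sub>R y - x) \<le> ereal b"
      using fin[of "2 *\<^sub>R y - x"] by (cases "p (2 *\<^sub>R y - x)") auto
    \<comment> \<open>The point \<open>y\<close> is the midpoint of \<open>x\<close> and a point with value below \<open>\<infinity>\<close>.\<close>
    have mid: "(1/2) *\<^sub>R x + (1/2) *\<^sub>R (2 *\<^sub>R y - x) = y" by (simp add: algebra_simps)
    have "p y \<le> ereal r" for r
      using ext_convexD[OF p, of x "2 * r - b" "2 *\<^sub>R y - x" b "1/2" "1/2"] x b
      unfolding mid by (simp add: field_simps)
    then show ?thesis using ereal_bot by blast
  qed
  then have "p = (\<lambda>_. -\<infinity>)" by blast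
  then show ?thesis by simp
next
  case False
  define q where "q v = real_of_ereal (p v)" for v
  have q: "p v = ereal (q v)" for v
    using False fin[of v] by (cases "p v") (auto simp: q_def)
  have "convex_on UNIV q"
    unfolding convex_on_def
  proof (intro conjI ballI allI impI convex_UNIV)
    fix x y and u w :: real assume "0 \<le> u" "0 \<le> w" "u + w = 1"
    then show "q (u *\<^sub>R x + w *\<^sub>R y) \<le> u * q x + w * q y"
      using ext_convexD[OF p, of x "q x" y "q y" u w] by (simp add: q)
  qed
  then have "continuous_on UNIV q" by (intro convex_on_continuous) auto
  then have "continuous_on UNIV (\<lambda>v. ereal (q v))" by (intro continuous_on_ereal)
  then show ?thesis by (simp add: q[symmetric])
qed

text \<open>Approximating the identity by simple functions replaces the second argument by one with finitely many values;
  continuity lets the approximation converge.\<close>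

lemma caratheodory_measurable:
  fixes h :: "'a \<Rightarrow> 'b::{metric_space, second_countable_topology} \<Rightarrow> ereal"
  assumes cont: "\<And>\<omega>. \<omega> \<in> space N \<Longrightarrow> continuous_on UNIV (h \<omega>)"
    and meas: "\<And>x. (\<lambda>\<omega>. h \<omega> x) \<in> borel_measurable N"
  shows "(\<lambda>(\<omega>, x). h \<omega> x) \<in> borel_measurable (N \<Otimes>\<^sub>M borel)"
proof -
  obtain F :: "nat \<Rightarrow> 'b \<Rightarrow> 'b" where F: "\<And>i. simple_function borel (F i)"
    "\<And>x. (\<lambda>i. F i x) \<longlonglongrightarrow> x"
    using borel_measurable_implies_sequence_metric[of "\<lambda>x. x" borel undefined] by auto
  have approx: "(\<lambda>p. h (fst p) (F i (snd p))) \<in> borel_measurable (N \<Otimes>\<^sub>M borel)" for i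
  proof (rule measurable_compose_countable'[where I = "range (F i)" and g = "\<lambda>p. F i (snd p)"
        and f = "\<lambda>x p. h (fst p) x"])
    show "(\<lambda>p. h (fst p) x) \<in> borel_measurable (N \<Otimes>\<^sub>M borel)" for x
      by (rule measurable_compose[OF measurable_fst meas])
    show "(\<lambda>p. F i (snd p)) \<in> N \<Otimes>\<^sub>M borel \<rightarrow>\<^sub>M count_space (range (F i))"
      by (rule measurable_compose[OF measurable_snd])
        (use measurable_simple_function[OF F(1)] in \<open>auto intro: measurable_count_space_extend
           simp: measurable_def\<close>)
    show "countable (range (F i))"
      using F(1)[of i] by (intro countable_finite) (simp add: simple_function_def)
  qed
  have "(\<lambda>p. limsup (\<lambda>i. h (fst p) (F i (snd p)))) \<in> borel_measurable (N \<Otimes>\<^sub>M borel)"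
    by (intro borel_measurable_limsup approx)
  also have "?this \<longleftrightarrow> ?thesis"
  proof (rule measurable_cong)
    fix p assume "p \<in> space (N \<Otimes>\<^sub>M (borel :: 'b measure))"
    then have "continuous_on UNIV (h (fst p))" by (intro cont) (auto simp: space_pair_measure)
    then have "(\<lambda>i. h (fst p) (F i (snd p))) \<longlonglongrightarrow> h (fst p) (snd p)"
      using F(2) by (auto intro: continuous_on_tendsto_compose)
    then show "limsup (\<lambda>i. h (fst p) (F i (snd p))) = (case p of (\<omega>, x) \<Rightarrow> h \<omega> x)"
      by (simp add: lim_imp_Limsup split_beta)
  qed
  finally show ?thesis .
qed

section \<open>The Bellman principle for hedging costs\<close>

lemma linear_risky: "linear (risky c)"
  by (rule linearI) (auto simp: risky_def vec_eq_iff)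

lemma risky_measurable [measurable]: "risky c \<in> borel_measurable borel"
  by (intro borel_measurable_continuous_onI linear_continuous_on linear_conv_bounded_linear[THEN iffD1] linear_risky)

context cost_market
begin

abbreviation (input) strats where "strats t \<xi> \<equiv> strategies M F T c t \<xi>"
abbreviation (input) cost where "cost \<xi> t v V \<omega> \<equiv> strategy_cost T S C c \<xi> t v V \<omega>"
abbreviation (input) hedge where "hedge \<xi> t v \<equiv> hedging_cost M F T S C c \<xi> t v"
abbreviation (input) worst_cost where
  "worst_cost \<xi> t v V \<equiv> cond_ess_sup M (F t) {\<lambda>\<omega>. ereal (cost \<xi> t v V \<omega>)}"

lemma complete_subalgebra_F: "t \<le> T \<Longrightarrow> complete_subalgebra M (F t)"
  using filtration_subalgebra filtration_complete filtration_mono[of 0 t]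
  by unfold_locales blast+

lemma measurable_F_Suc: "t < T \<Longrightarrow> f \<in> measurable (F t) L \<Longrightarrow> f \<in> measurable (F (Suc t)) L"
  using filtration_subalgebra[of t] filtration_subalgebra[of "Suc t"] filtration_mono[of t "Suc t"]
  by (intro measurable_from_subalg[of "F (Suc t)" "F t"]) (auto simp: subalgebra_def)

lemma cost_measurable:
  assumes "t \<le> T" "X \<in> borel_measurable N" "W \<in> borel_measurable N" "V \<in> borel_measurable N"
  shows "(\<lambda>\<omega>. C t (X \<omega>) (risky c (W \<omega> - V \<omega>))) \<in> borel_measurable N"
proof -
  note [measurable] = assms(2-4)
  have "(\<lambda>\<omega>. (X \<omega>, risky c (W \<omega> - V \<omega>))) \<in> borel_measurable N"
    by (intro borel_measurable_Pair) measurable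
  from measurable_compose[OF this cost_borel[OF assms(1)]] show ?thesis by simp
qed

lemma strategy_cost_step:
  assumes "t < T"
  shows "cost \<xi> t v V \<omega> = C t (S t \<omega>) (risky c (V t \<omega> - v \<omega>)) + cost \<xi> (Suc t) (V t) V \<omega>"
proof -
  have "increment t v V s \<omega> = increment (Suc t) (V t) V s \<omega>" if "s \<in> {Suc t..T}" for s
    using that by (auto simp: increment_def)
  then have "(\<Sum>s=Suc t..T. C s (S s \<omega>) (risky c (increment t v V s \<omega>))) =
      (\<Sum>s=Suc t..T. C s (S s \<omega>) (risky c (increment (Suc t) (V t) V s \<omega>)))"
    by (intro sum.cong) simp_all
  then show ?thesis
    using assms by (simp add: strategy_cost_def sum.atLeast_Suc_atMost increment_def[of t v V t])
qed

lemma strategies_nonempty: "strats t \<xi> \<noteq> {}"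
proof -
  have "(\<lambda>s. if s = T then \<xi> else (\<lambda>_. 0)) \<in> strats t \<xi>" by (simp add: strategies_def)
  then show ?thesis by blast
qed

lemma
  assumes t: "t \<le> T"
  shows hedging_cost_measurable: "hedge \<xi> t v \<in> borel_measurable (F t)"
    and hedging_cost_le: "\<And>V. V \<in> strats t \<xi> \<Longrightarrow> AE \<omega> in M. hedge \<xi> t v \<omega> \<le> worst_cost \<xi> t v V \<omega>"
    and hedging_cost_greatest: "\<And>Z. Z \<in> borel_measurable (F t) \<Longrightarrow>
      (\<And>V. V \<in> strats t \<xi> \<Longrightarrow> AE \<omega> in M. Z \<omega> \<le> worst_cost \<xi> t v V \<omega>) \<Longrightarrow>
      AE \<omega> in M. Z \<omega> \<le> hedge \<xi> t v \<omega>"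
    and hedging_cost_sequence: "\<exists>V :: nat \<Rightarrow> nat \<Rightarrow> 'a \<Rightarrow> real^'d. (\<forall>n. V n \<in> strats t \<xi>) \<and>
      (AE \<omega> in M. (INF n. worst_cost \<xi> t v (V n) \<omega>) \<le> hedge \<xi> t v \<omega>)"
proof -
  interpret complete_subalgebra M "F t" by (rule complete_subalgebra_F[OF t])
  let ?X = "(\<lambda>V. worst_cost \<xi> t v V) ` strats t \<xi>"
  have ne: "?X \<noteq> {}" using strategies_nonempty by simp
  have meas: "?X \<subseteq> borel_measurable (F t)" using cond_ess_sup_measurable by blast
  show "hedge \<xi> t v \<in> borel_measurable (F t)"
    unfolding hedging_cost_def by (rule cond_ess_inf_measurable[OF ne meas])
  show "AE \<omega> in M. hedge \<xi> t v \<omega> \<le> worst_cost \<xi> t v V \<omega>" if "V \<in> strats t \<xi>" for V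
    unfolding hedging_cost_def by (rule cond_ess_inf_lower[OF ne meas]) (use that in blast)
  show "AE \<omega> in M. Z \<omega> \<le> hedge \<xi> t v \<omega>" if "Z \<in> borel_measurable (F t)"
    "\<And>V. V \<in> strats t \<xi> \<Longrightarrow> AE \<omega> in M. Z \<omega> \<le> worst_cost \<xi> t v V \<omega>" for Z
    unfolding hedging_cost_def
    by (rule cond_ess_inf_greatest[OF ne meas that(1)]) (use that(2) in blast)
  obtain X :: "nat \<Rightarrow> 'a \<Rightarrow> ereal" where X: "\<forall>n. X n \<in> ?X"
    and le: "AE \<omega> in M. (INF n. X n \<omega>) \<le> hedge \<xi> t v \<omega>"
    using cond_ess_inf_sequence[OF ne meas] unfolding hedging_cost_def by blast
  have "\<forall>n. \<exists>V. V \<in> strats t \<xi> \<and> X n = worst_cost \<xi> t v V" using X by blast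
  then have "\<exists>V. \<forall>n. V n \<in> strats t \<xi> \<and> X n = worst_cost \<xi> t v (V n)" by (rule choice)
  then obtain V where "\<And>n. V n \<in> strats t \<xi>" "\<And>n. X n = worst_cost \<xi> t v (V n)" by blast
  then show "\<exists>V :: nat \<Rightarrow> nat \<Rightarrow> 'a \<Rightarrow> real^'d. (\<forall>n. V n \<in> strats t \<xi>) \<and>
      (AE \<omega> in M. (INF n. worst_cost \<xi> t v (V n) \<omega>) \<le> hedge \<xi> t v \<omega>)"
    using le by (intro exI[of _ V]) simp
qed

text \<open>The index is known at time \<open>t\<close>, hence at all later times, so the choice among the countably many strategies
  remains measurable as time goes on.\<close>

lemma strategies_paste:
  fixes V :: "nat \<Rightarrow> nat \<Rightarrow> 'a \<Rightarrow> real^'d" and idx :: "'a \<Rightarrow> nat"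
  assumes V: "\<And>n. V n \<in> strats t \<xi>" and idx: "idx \<in> F t \<rightarrow>\<^sub>M count_space UNIV"
  shows "(\<lambda>s \<omega>. V (idx \<omega>) s \<omega>) \<in> strats t \<xi>"
  unfolding strategies_def
proof (intro CollectI conjI ballI)
  fix s assume s: "s \<in> {t..<T}"
  have "idx \<in> F s \<rightarrow>\<^sub>M count_space UNIV"
    using s filtration_subalgebra[of t] filtration_subalgebra[of s] filtration_mono[of t s]
    by (intro measurable_from_subalg[OF _ idx]) (auto simp: subalgebra_def)
  then show "(\<lambda>\<omega>. V (idx \<omega>) s \<omega>) \<in> borel_measurable (F s)"
    by (rule measurable_compose_countable[rotated]) (use V s in \<open>auto simp: strategies_def\<close>)
next
  show "risky c (V (idx \<omega>) T \<omega>) = risky c (\<xi> \<omega>)" if "\<omega> \<in> space M" for \<omega>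
    using V that by (auto simp: strategies_def)
qed

text \<open>The easy half of the Bellman principle: subtracting the trading cost of time \<open>t\<close>, known at that time, from
  the worst case seen at time \<open>t\<close> leaves a bound for the remaining cost, hence for its worst case seen one step
  later.\<close>

lemma hedging_cost_Suc_le:
  assumes t: "t < T" and v: "v \<in> borel_measurable (F t)" and V: "V \<in> strats t \<xi>"
  shows "AE \<omega> in M. hedge \<xi> (Suc t) (V t) \<omega> \<le>
    worst_cost \<xi> t v V \<omega> - ereal (C t (S t \<omega>) (risky c (V t \<omega> - v \<omega>)))"
    (is "AE \<omega> in M. _ \<le> ?D \<omega>")
proof -
  interpret now: complete_subalgebra M "F t" using complete_subalgebra_F t by simp
  interpret later: complete_subalgebra M "F (Suc t)" using complete_subalgebra_F t by simp
  have Vt: "V t \<in> borel_measurable (F t)" using V t by (simp add: strategies_def)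
  have VS: "V \<in> strats (Suc t) \<xi>" using V by (auto simp: strategies_def)
  have "(\<lambda>\<omega>. C t (S t \<omega>) (risky c (V t \<omega> - v \<omega>))) \<in> borel_measurable (F t)"
    using t by (intro cost_measurable price_adapted Vt v) auto
  then have "?D \<in> borel_measurable (F t)"
    by (intro borel_measurable_ereal_diff now.cond_ess_sup_measurable borel_measurable_ereal)
  then have D: "?D \<in> borel_measurable (F (Suc t))" by (rule measurable_F_Suc[OF t])
  have shift: "ereal y \<le> e - ereal x" if "ereal (x + y) \<le> e" for x y e
    using that by (cases e) auto
  have "AE \<omega> in M. ereal (cost \<xi> t v V \<omega>) \<le> worst_cost \<xi> t v V \<omega>"
    by (rule now.cond_ess_sup_upper)
  then have "AE \<omega> in M. ereal (cost \<xi> (Suc t) (V t) V \<omega>) \<le> ?D \<omega>"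
    by eventually_elim (intro shift, simp only: strategy_cost_step[OF t])
  then have "AE \<omega> in M. worst_cost \<xi> (Suc t) (V t) V \<omega> \<le> ?D \<omega>"
    by (rule later.cond_ess_sup_least[OF D])
  moreover have "AE \<omega> in M. hedge \<xi> (Suc t) (V t) \<omega> \<le> worst_cost \<xi> (Suc t) (V t) V \<omega>"
    using t VS by (intro hedging_cost_le) auto
  ultimately show ?thesis by eventually_elim (rule order_trans)
qed

text \<open>The other half of the Bellman principle: where the remaining budget exceeds the next hedging cost, some member of a
  countable minimizing family of strategies stays within the budget, and the first such members are pasted together.
  Comparing with a fixed level \<open>r\<close> rather than approximating the next hedging cost treats the values
  \<open>\<plusminus>\<infinity>\<close> uniformly.\<close>

lemma hedging_cost_le_on:
  assumes t: "t < T" and v: "v \<in> borel_measurable (F t)" and W: "W \<in> borel_measurable (F t)"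
    and A: "A \<in> sets (F t)"
    and less: "AE \<omega> in M. \<omega> \<in> A \<longrightarrow>
      hedge \<xi> (Suc t) W \<omega> < ereal (r - C t (S t \<omega>) (risky c (W \<omega> - v \<omega>)))"
  shows "AE \<omega> in M. \<omega> \<in> A \<longrightarrow> hedge \<xi> t v \<omega> \<le> ereal r"
proof -
  interpret now: complete_subalgebra M "F t" using complete_subalgebra_F t by simp
  interpret later: complete_subalgebra M "F (Suc t)" using complete_subalgebra_F t by simp
  let ?\<rho> = "\<lambda>\<omega>. r - C t (S t \<omega>) (risky c (W \<omega> - v \<omega>))"
  obtain V :: "nat \<Rightarrow> nat \<Rightarrow> 'a \<Rightarrow> real^'d" where V: "\<And>n. V n \<in> strats (Suc t) \<xi>"
    and inf: "AE \<omega> in M. (INF n. worst_cost \<xi> (Suc t) W (V n) \<omega>) \<le> hedge \<xi> (Suc t) W \<omega>"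
    using hedging_cost_sequence[of "Suc t" \<xi> W] t by auto
  have "(\<lambda>\<omega>. C t (S t \<omega>) (risky c (W \<omega> - v \<omega>))) \<in> borel_measurable (F t)"
    using t by (intro cost_measurable price_adapted W v) auto
  then have \<rho>[measurable]: "?\<rho> \<in> borel_measurable (F (Suc t))"
    by (intro measurable_F_Suc[OF t] borel_measurable_diff borel_measurable_const)
  have E[measurable]: "worst_cost \<xi> (Suc t) W (V n) \<in> borel_measurable (F (Suc t))" for n
    by (rule later.cond_ess_sup_measurable)
  \<comment> \<open>Up to a null set, an index qualifies everywhere on \<open>A\<close>; the value elsewhere does not matter, as
    nothing is claimed off \<open>A\<close>.\<close>
  define idx where "idx \<omega> = (LEAST n. worst_cost \<xi> (Suc t) W (V n) \<omega> < ereal (?\<rho> \<omega>))" for \<omega>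
  have idx: "idx \<in> F (Suc t) \<rightarrow>\<^sub>M count_space UNIV"
    unfolding idx_def by (intro measurable_Least) measurable
  define U where "U = (\<lambda>s \<omega>. V (idx \<omega>) s \<omega>)(t := W)"
  have pasted: "(\<lambda>s \<omega>. V (idx \<omega>) s \<omega>) \<in> strats (Suc t) \<xi>" by (rule strategies_paste[OF V idx])
  have U: "U \<in> strats t \<xi>"
    unfolding strategies_def
  proof (intro CollectI conjI ballI)
    show "U s \<in> borel_measurable (F s)" if "s \<in> {t..<T}" for s
    proof (cases "s = t")
      case True then show ?thesis by (simp add: U_def W)
    next
      case False then show ?thesis using that pasted by (auto simp: U_def strategies_def)
    qed
    show "risky c (U T \<omega>) = risky c (\<xi> \<omega>)" if "\<omega> \<in> space M" for \<omega>
      using that t pasted by (auto simp: U_def strategies_def)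
  qed
  have U_cost: "cost \<xi> t v U \<omega> =
      C t (S t \<omega>) (risky c (W \<omega> - v \<omega>)) + cost \<xi> (Suc t) W (V (idx \<omega>)) \<omega>" for \<omega>
  proof -
    have "increment (Suc t) W U s \<omega> = increment (Suc t) W (V (idx \<omega>)) s \<omega>" if "s \<in> {Suc t..T}" for s
      using that by (auto simp: increment_def U_def)
    then have "cost \<xi> (Suc t) W U \<omega> = cost \<xi> (Suc t) W (V (idx \<omega>)) \<omega>"
      unfolding strategy_cost_def by (intro arg_cong2[where f = "(+)"] refl sum.cong) simp_all
    moreover have "U t = W" by (simp add: U_def)
    ultimately show ?thesis using strategy_cost_step[OF t, of \<xi> v U \<omega>] by simp
  qed
  have "AE \<omega> in M. \<forall>n. ereal (cost \<xi> (Suc t) W (V n) \<omega>) \<le> worst_cost \<xi> (Suc t) W (V n) \<omega>"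
    unfolding AE_all_countable by (intro allI later.cond_ess_sup_upper)
  with less inf have "AE \<omega> in M. ereal (cost \<xi> t v U \<omega>) \<le> (if \<omega> \<in> A then ereal r else \<infinity>)"
  proof eventually_elim
    case (elim \<omega>)
    show ?case
    proof (cases "\<omega> \<in> A")
      case True
      then have "(INF n. worst_cost \<xi> (Suc t) W (V n) \<omega>) < ereal (?\<rho> \<omega>)"
        using elim by (blast intro: le_less_trans)
      then have "\<exists>n. worst_cost \<xi> (Suc t) W (V n) \<omega> < ereal (?\<rho> \<omega>)" by (simp add: INF_less_iff)
      then have "worst_cost \<xi> (Suc t) W (V (idx \<omega>)) \<omega> < ereal (?\<rho> \<omega>)"
        unfolding idx_def by (rule LeastI_ex)
      then have "ereal (cost \<xi> (Suc t) W (V (idx \<omega>)) \<omega>) < ereal (?\<rho> \<omega>)"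
        using elim(3) by (blast intro: le_less_trans)
      then show ?thesis using True by (simp add: U_cost)
    qed simp
  qed
  then have "AE \<omega> in M. worst_cost \<xi> t v U \<omega> \<le> (if \<omega> \<in> A then ereal r else \<infinity>)"
    by (rule now.cond_ess_sup_least[rotated]) (intro measurable_If_set measurable_const, use sets.Int[OF A sets.top] in auto)
  moreover have "AE \<omega> in M. hedge \<xi> t v \<omega> \<le> worst_cost \<xi> t v U \<omega>"
    using t U by (intro hedging_cost_le) auto
  ultimately show ?thesis
    by eventually_elim (auto intro: order_trans)
qed

end

section \<open>The one-step problem\<close>

definition one_step_cost ::
    "(real^'m \<Rightarrow> real^'d::finite \<Rightarrow> real) \<Rightarrow> 'd \<Rightarrow> (real^'m::finite \<Rightarrow> real^'d \<Rightarrow> ereal) \<Rightarrow>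
     real^'m \<Rightarrow> real^'d \<Rightarrow> ereal"
  where "one_step_cost K c f s v = (INF y. ereal (K s (risky c (y - v))) + f s y)"

lemma ext_convex_one_step_cost:
  assumes "convex_on UNIV (K s)" "ext_convex (f s)"
  shows "ext_convex (one_step_cost K c f s)"
  unfolding one_step_cost_def[abs_def]
  by (rule ext_convex_infimal_convolution[OF assms(1) linear_risky assms(2)])

text \<open>The trading cost is finite, so the one-step cost is either identically \<open>\<infinity>\<close> or nowhere \<open>\<infinity>\<close>. This
  gives lower semicontinuity for every price without attaining the infimum.\<close>

lemma continuous_one_step_cost:
  assumes "convex_on UNIV (K s)" "ext_convex (f s)"
  shows "continuous_on UNIV (one_step_cost K c f s)"
proof (cases "\<exists>y. f s y < \<infinity>")
  case True
  then obtain y where y: "f s y < \<infinity>" by blast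
  show ?thesis
  proof (rule ext_convex_continuous[OF ext_convex_one_step_cost[of K s f, OF assms]])
    fix v
    have "one_step_cost K c f s v \<le> ereal (K s (risky c (y - v))) + f s y"
      unfolding one_step_cost_def by (rule INF_lower) simp
    also have "\<dots> < \<infinity>" using y by (cases "f s y") auto
    finally show "one_step_cost K c f s v < \<infinity>" .
  qed
next
  case False
  then have "f s y = \<infinity>" for y by (auto simp: less_top[symmetric])
  then have "one_step_cost K c f s = (\<lambda>_. \<infinity>)" by (simp add: one_step_cost_def[abs_def])
  then show ?thesis by simp
qed

context cost_market
begin

context
  fixes t :: nat and f :: "real^'m \<Rightarrow> real^'d \<Rightarrow> ereal"
  assumes t: "t < T" and f: "(\<lambda>(s, y). f s y) \<in> borel_measurable borel"
begin

lemma objective_sublevel_borel: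
  "{((s, v), y). ereal (C t s (risky c (y - v))) + f s y < r} \<in> sets borel"
proof -
  let ?N = "(borel \<Otimes>\<^sub>M borel) \<Otimes>\<^sub>M borel :: (((real^'m) \<times> (real^'d)) \<times> (real^'d)) measure"
  have "(\<lambda>p. C t (fst (fst p)) (risky c (snd p - snd (fst p)))) \<in> borel_measurable ?N"
    using t by (intro cost_measurable) (auto intro!: measurable_compose[OF measurable_fst])
  moreover have "(\<lambda>p. (fst (fst p), snd p)) \<in> borel_measurable ?N"
    by (intro borel_measurable_Pair) measurable
  from measurable_compose[OF this f] have "(\<lambda>p. f (fst (fst p)) (snd p)) \<in> borel_measurable ?N"
    by simp
  ultimately have "{p \<in> space ?N. ereal (C t (fst (fst p)) (risky c (snd p - snd (fst p)))) +
      f (fst (fst p)) (snd p) < r} \<in> sets ?N"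
    by measurable
  also have "sets ?N = sets borel" by (simp only: borel_prod)
  also have "{p \<in> space ?N. ereal (C t (fst (fst p)) (risky c (snd p - snd (fst p)))) +
      f (fst (fst p)) (snd p) < r} = {((s, v), y). ereal (C t s (risky c (y - v))) + f s y < r}"
    by (auto simp: space_pair_measure)
  finally show ?thesis .
qed

text \<open>An infimum below \<open>r\<close> is a point in the projection of a Borel set, to which the selection
  theorem applies.\<close>

lemma one_step_cost_less_iff:
  "one_step_cost (C t) c f s v < r \<longleftrightarrow>
    (s, v) \<in> fst ` {((s, v), y). ereal (C t s (risky c (y - v))) + f s y < r}"
  unfolding one_step_cost_def INF_less_iff by force

lemma price_position_measurable:
  fixes v :: "'a \<Rightarrow> real^'d"
  assumes "v \<in> borel_measurable (F t)"
  shows "(\<lambda>\<omega>. (S t \<omega>, v \<omega>)) \<in> borel_measurable (F t)"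
  by (intro borel_measurable_Pair assms price_adapted less_imp_le[OF t])

lemma one_step_cost_measurable:
  assumes v: "v \<in> borel_measurable (F t)"
  shows "(\<lambda>\<omega>. one_step_cost (C t) c f (S t \<omega>) (v \<omega>)) \<in> borel_measurable (F t)"
proof (rule borel_measurableI_less)
  interpret complete_subalgebra M "F t" using complete_subalgebra_F t by simp
  show "{\<omega> \<in> space (F t). one_step_cost (C t) c f (S t \<omega>) (v \<omega>) < r} \<in> sets (F t)" for r
    unfolding one_step_cost_less_iff space_N
    by (rule measurable_projection[OF price_position_measurable[OF v] objective_sublevel_borel])
qed

lemma one_step_cost_selection:
  assumes v: "v \<in> borel_measurable (F t)"
  shows "\<exists>W \<in> borel_measurable (F t). AE \<omega> in M. one_step_cost (C t) c f (S t \<omega>) (v \<omega>) < r \<longrightarrow>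
    ereal (C t (S t \<omega>) (risky c (W \<omega> - v \<omega>))) + f (S t \<omega>) (W \<omega>) < r"
proof -
  interpret complete_subalgebra M "F t" using complete_subalgebra_F t by simp
  show ?thesis
    using measurable_selection[OF price_position_measurable[OF v] objective_sublevel_borel[of r]]
    unfolding one_step_cost_less_iff by simp
qed

text \<open>The hypotheses say that \<open>f (S t) W\<close> is the conditional essential supremum, given time \<open>t\<close>, of
  the next hedging cost from the position \<open>W\<close>. Minimizing over random positions \<open>W\<close> is then the same as minimizing
  pointwise over \<open>y\<close>: for every rational \<open>r\<close>, measurable selection provides a position whose cost is below \<open>r\<close> wherever
  the pointwise infimum is.\<close>

theorem dynamic_programming:
  assumes next_le: "\<And>W. W \<in> borel_measurable (F t) \<Longrightarrow>
      AE \<omega> in M. hedge \<xi> (Suc t) W \<omega> \<le> f (S t \<omega>) (W \<omega>)"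
    and least: "\<And>W Z. W \<in> borel_measurable (F t) \<Longrightarrow> Z \<in> borel_measurable (F t) \<Longrightarrow>
      AE \<omega> in M. hedge \<xi> (Suc t) W \<omega> \<le> Z \<omega> \<Longrightarrow> AE \<omega> in M. f (S t \<omega>) (W \<omega>) \<le> Z \<omega>"
    and v: "v \<in> borel_measurable (F t)"
  shows "AE \<omega> in M. hedge \<xi> t v \<omega> = one_step_cost (C t) c f (S t \<omega>) (v \<omega>)"
proof -
  interpret complete_subalgebra M "F t" using complete_subalgebra_F t by simp
  let ?I = "\<lambda>\<omega>. one_step_cost (C t) c f (S t \<omega>) (v \<omega>)"
  have I: "?I \<in> borel_measurable (F t)" by (rule one_step_cost_measurable[OF v])
  have "AE \<omega> in M. ?I \<omega> \<le> worst_cost \<xi> t v V \<omega>" if V: "V \<in> strats t \<xi>" for V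
  proof -
    have Vt: "V t \<in> borel_measurable (F t)" using V t by (simp add: strategies_def)
    have "(\<lambda>\<omega>. C t (S t \<omega>) (risky c (V t \<omega> - v \<omega>))) \<in> borel_measurable (F t)"
      using t by (intro cost_measurable price_adapted Vt v) auto
    then have "(\<lambda>\<omega>. worst_cost \<xi> t v V \<omega> - ereal (C t (S t \<omega>) (risky c (V t \<omega> - v \<omega>))))
        \<in> borel_measurable (F t)"
      by (intro borel_measurable_ereal_diff cond_ess_sup_measurable borel_measurable_ereal)
    then have "AE \<omega> in M. f (S t \<omega>) (V t \<omega>) \<le>
        worst_cost \<xi> t v V \<omega> - ereal (C t (S t \<omega>) (risky c (V t \<omega> - v \<omega>)))"
      by (rule least[OF Vt _ hedging_cost_Suc_le[OF t v V]])
    then show ?thesis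
    proof eventually_elim
      case (elim \<omega>)
      have unshift: "ereal x + y \<le> z" if "y \<le> z - ereal x" for x y z
        using that by (cases y; cases z) auto
      have "?I \<omega> \<le> ereal (C t (S t \<omega>) (risky c (V t \<omega> - v \<omega>))) + f (S t \<omega>) (V t \<omega>)"
        unfolding one_step_cost_def by (rule INF_lower) simp
      also have "\<dots> \<le> worst_cost \<xi> t v V \<omega>" by (rule unshift[OF elim])
      finally show ?case .
    qed
  qed
  then have lower: "AE \<omega> in M. ?I \<omega> \<le> hedge \<xi> t v \<omega>"
    using t by (intro hedging_cost_greatest I) auto
  have upper_r: "AE \<omega> in M. ?I \<omega> < ereal r \<longrightarrow> hedge \<xi> t v \<omega> \<le> ereal r" for r
  proof -
    obtain W where W: "W \<in> borel_measurable (F t)"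
      and sel: "AE \<omega> in M. ?I \<omega> < ereal r \<longrightarrow>
        ereal (C t (S t \<omega>) (risky c (W \<omega> - v \<omega>))) + f (S t \<omega>) (W \<omega>) < ereal r"
      using one_step_cost_selection[OF v, of "ereal r"] by blast
    define A where "A = {\<omega> \<in> space (F t). ?I \<omega> < ereal r}"
    have A: "A \<in> sets (F t)" unfolding A_def using I by measurable
    have "AE \<omega> in M. \<omega> \<in> A \<longrightarrow>
        hedge \<xi> (Suc t) W \<omega> < ereal (r - C t (S t \<omega>) (risky c (W \<omega> - v \<omega>)))"
      using sel next_le[OF W]
    proof eventually_elim
      case (elim \<omega>)
      have shift: "y < ereal (r - x)" if "ereal x + y < ereal r" for x y
        using that by (cases y) auto
      show ?case
        using elim shift by (auto simp: A_def intro: le_less_trans)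
    qed
    then have "AE \<omega> in M. \<omega> \<in> A \<longrightarrow> hedge \<xi> t v \<omega> \<le> ereal r"
      by (rule hedging_cost_le_on[OF t v W A])
    with AE_space show ?thesis by eventually_elim (simp add: A_def)
  qed
  have "AE \<omega> in M. \<forall>q::rat. ?I \<omega> < ereal (of_rat q) \<longrightarrow> hedge \<xi> t v \<omega> \<le> ereal (of_rat q)"
    by (subst AE_all_countable) (intro allI upper_r)
  with lower show ?thesis
  proof eventually_elim
    case (elim \<omega>)
    have "\<not> ?I \<omega> < hedge \<xi> t v \<omega>"
    proof
      assume "?I \<omega> < hedge \<xi> t v \<omega>"
      then obtain q where "?I \<omega> < ereal (of_rat q)" "ereal (of_rat q) < hedge \<xi> t v \<omega>"
        using ereal_dense3 by blast
      then show False using elim(2) by (meson leD)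
    qed
    then show ?case using elim(1) by simp
  qed
qed

lemma normal_integrand_one_step_cost:
  assumes "\<And>s. convex_on UNIV (C t s)" "\<And>s. ext_convex (f s)"
  shows "normal_integrand (F t) (\<lambda>\<omega>. one_step_cost (C t) c f (S t \<omega>))"
  unfolding normal_integrand_def
proof (intro conjI ballI)
  have cont: "continuous_on UNIV (one_step_cost (C t) c f s)" for s
    by (rule continuous_one_step_cost) (rule assms)+
  then show "(\<lambda>(\<omega>, v). one_step_cost (C t) c f (S t \<omega>) v) \<in> borel_measurable (F t \<Otimes>\<^sub>M borel)"
    by (intro caratheodory_measurable one_step_cost_measurable) auto
  show "lsc (one_step_cost (C t) c f (S t \<omega>))" for \<omega>
    unfolding lsc_def by (intro allI closed_Collect_le cont continuous_on_const)
qed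

end

end

section \<open>The recursion for hedging costs\<close>

theorem corollary4p9:
  fixes M :: "'a measure"
    and F :: "nat \<Rightarrow> 'a measure"
    and T t :: nat
    and S :: "nat \<Rightarrow> 'a \<Rightarrow> real^'m::finite"
    and C :: "nat \<Rightarrow> real^'m \<Rightarrow> real^'d::finite \<Rightarrow> real"
    and c :: 'd
    and \<xi> :: "'a \<Rightarrow> real^'d"
    and g :: "real^'m \<Rightarrow> real^'d \<Rightarrow> ereal"
    and \<alpha> :: "nat \<Rightarrow> nat \<Rightarrow> real^'m \<Rightarrow> real^'m"
  assumes market: "cost_market M F T S C c"
    and t: "t < T"
    and payoff: "\<xi> \<in> borel_measurable (F T)"
    and hedgeable: "hedgeable M F T S C c \<xi>"
    and AEP: "AEP M F T S C c"
    and next_cost: "\<And>V. V \<in> borel_measurable (F t) \<Longrightarrow>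
          AE \<omega> in M. hedging_cost M F T S C c \<xi> (Suc t) V \<omega> = g (S (Suc t) \<omega>) (V \<omega>)"
    and \<alpha>_borel: "\<And>u k. u < T \<Longrightarrow> k \<ge> 1 \<Longrightarrow> \<alpha> u k \<in> borel_measurable borel"
    and cases:
      "(lsc (\<lambda>(s, v). g s v) \<and>
         (\<forall>u<T. is_cond_support M (F u) (S (Suc u)) (\<lambda>\<omega>. closure {\<alpha> u k (S u \<omega>) | k. k \<ge> 1})))
       \<or>
       ((\<lambda>(s, v). g s v) \<in> borel_measurable borel \<and>
         (\<forall>u<T. (AE \<omega> in M. S (Suc u) \<omega> \<in> {\<alpha> u k (S u \<omega>) | k. k \<ge> 1}) \<and>
           (\<forall>k\<ge>1. AE \<omega> in M.
              real_cond_exp M (F u) (indicator {\<omega>\<in>space M. S (Suc u) \<omega> = \<alpha> u k (S u \<omega>)}) \<omega> > 0)))"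
    and g_convex: "\<And>s. ext_convex (g s)"
  shows "\<exists>g' :: real^'m \<Rightarrow> real^'d \<Rightarrow> ereal.
      (\<forall>V\<in>borel_measurable (F t).
          AE \<omega> in M. hedging_cost M F T S C c \<xi> t V \<omega> = g' (S t \<omega>) (V \<omega>)) \<and>
      ((\<forall>s. convex_on UNIV (C t s)) \<longrightarrow>
          normal_integrand (F t) (\<lambda>\<omega>. g' (S t \<omega>)) \<and> (\<forall>s. ext_convex (g' s))) \<and>
      (\<forall>s v. g' s v = (INF y. ereal (C t s (risky c (y - v))) + (SUP k\<in>{1..}. g (\<alpha> t k s) y)))"
proof -
  interpret cost_market M F T S C c by (rule market)
  interpret now: complete_subalgebra M "F t" using complete_subalgebra_F t by simp
  define f where "f s y = (SUP k\<in>{1..}. g (\<alpha> t k s) y)" for s y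
  have g_borel: "(\<lambda>(s, v). g s v) \<in> borel_measurable borel"
    using cases lsc_borel_measurable by blast
  have f_borel: "(\<lambda>(s, y). f s y) \<in> borel_measurable borel"
  proof -
    have "(\<lambda>p. g (\<alpha> t k (fst p)) (snd p)) \<in> borel_measurable borel" if k: "k \<in> {1..}" for k
    proof -
      have "(\<lambda>p :: (real^'m) \<times> (real^'d). (\<alpha> t k (fst p), snd p)) \<in> borel_measurable borel"
        using k by (intro borel_measurable_Pair measurable_compose[OF _ \<alpha>_borel[OF t]]
            borel_measurable_continuous_onI continuous_intros) simp
      from measurable_compose[OF this g_borel] show ?thesis by simp
    qed
    then have "(\<lambda>p. SUP k\<in>{1..}. g (\<alpha> t k (fst p)) (snd p)) \<in> borel_measurable borel"
      by (intro borel_measurable_SUP) auto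
    then show ?thesis by (simp add: f_def split_beta)
  qed
  have f_convex: "ext_convex (f s)" for s
    unfolding f_def[abs_def] by (intro ext_convex_SUP g_convex)
  have S_t: "S t \<in> borel_measurable (F t)" using t by (intro price_adapted) simp
  have S_Suc: "S (Suc t) \<in> borel_measurable M"
    using t price_adapted[of "Suc t"] filtration_subalgebra[of "Suc t"]
    by (auto intro: measurable_from_subalg)
  have dominated: "AE \<omega> in M. g (S (Suc t) \<omega>) (W \<omega>) \<le> f (S t \<omega>) (W \<omega>)" for W
    using cases
  proof
    assume "lsc (\<lambda>(s, v). g s v) \<and>
      (\<forall>u<T. is_cond_support M (F u) (S (Suc u)) (\<lambda>\<omega>. closure {\<alpha> u k (S u \<omega>) | k. k \<ge> 1}))"
    then show ?thesis
      unfolding f_def using t by (intro now.cond_support_dominates) auto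
  next
    assume "(\<lambda>(s, v). g s v) \<in> borel_measurable borel \<and>
      (\<forall>u<T. (AE \<omega> in M. S (Suc u) \<omega> \<in> {\<alpha> u k (S u \<omega>) | k. k \<ge> 1}) \<and>
        (\<forall>k\<ge>1. AE \<omega> in M.
           real_cond_exp M (F u) (indicator {\<omega>\<in>space M. S (Suc u) \<omega> = \<alpha> u k (S u \<omega>)}) \<omega> > 0))"
    then have "AE \<omega> in M. S (Suc t) \<omega> \<in> {\<alpha> t k (S t \<omega>) | k. k \<ge> 1}" using t by blast
    then show ?thesis
      by eventually_elim (auto simp: f_def intro!: SUP_upper2)
  qed
  have least: "AE \<omega> in M. f (S t \<omega>) (W \<omega>) \<le> Z \<omega>"
    if W: "W \<in> borel_measurable (F t)" and Z: "Z \<in> borel_measurable (F t)"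
      and le: "AE \<omega> in M. g (S (Suc t) \<omega>) (W \<omega>) \<le> Z \<omega>" for W Z
    using cases
  proof
    assume "lsc (\<lambda>(s, v). g s v) \<and>
      (\<forall>u<T. is_cond_support M (F u) (S (Suc u)) (\<lambda>\<omega>. closure {\<alpha> u k (S u \<omega>) | k. k \<ge> 1}))"
    then show ?thesis
      unfolding f_def using t
      by (intro now.cond_support_least[where Y = "S (Suc t)" and a = "\<lambda>k \<omega>. \<alpha> t k (S t \<omega>)"] W Z le) auto
  next
    assume "(\<lambda>(s, v). g s v) \<in> borel_measurable borel \<and>
      (\<forall>u<T. (AE \<omega> in M. S (Suc u) \<omega> \<in> {\<alpha> u k (S u \<omega>) | k. k \<ge> 1}) \<and>
        (\<forall>k\<ge>1. AE \<omega> in M.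
           real_cond_exp M (F u) (indicator {\<omega>\<in>space M. S (Suc u) \<omega> = \<alpha> u k (S u \<omega>)}) \<omega> > 0))"
    then have "\<And>k. k \<ge> 1 \<Longrightarrow> AE \<omega> in M.
        real_cond_exp M (F t) (indicator {\<omega>\<in>space M. S (Suc t) \<omega> = \<alpha> t k (S t \<omega>)}) \<omega> > 0"
      using t by blast
    then show ?thesis
      unfolding f_def
      by (intro now.cond_atoms_least[where Y = "S (Suc t)" and a = "\<lambda>k \<omega>. \<alpha> t k (S t \<omega>)"]
          g_borel S_Suc measurable_compose[OF S_t \<alpha>_borel[OF t]] W Z le)
  qed
  have "AE \<omega> in M. hedging_cost M F T S C c \<xi> t V \<omega> = one_step_cost (C t) c f (S t \<omega>) (V \<omega>)"
    if V: "V \<in> borel_measurable (F t)" for V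
  proof (rule dynamic_programming[OF t f_borel _ _ V])
    show "AE \<omega> in M. hedging_cost M F T S C c \<xi> (Suc t) W \<omega> \<le> f (S t \<omega>) (W \<omega>)"
      if "W \<in> borel_measurable (F t)" for W
      using next_cost[OF that] dominated[of W] by eventually_elim simp
    show "AE \<omega> in M. f (S t \<omega>) (W \<omega>) \<le> Z \<omega>"
      if W: "W \<in> borel_measurable (F t)" and Z: "Z \<in> borel_measurable (F t)"
        and le: "AE \<omega> in M. hedging_cost M F T S C c \<xi> (Suc t) W \<omega> \<le> Z \<omega>" for W Z
    proof (rule least[OF W Z])
      show "AE \<omega> in M. g (S (Suc t) \<omega>) (W \<omega>) \<le> Z \<omega>"
        using next_cost[OF W] le by eventually_elim simp
    qed
  qed
  moreover have "normal_integrand (F t) (\<lambda>\<omega>. one_step_cost (C t) c f (S t \<omega>))"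
    "ext_convex (one_step_cost (C t) c f s)" if "\<forall>s. convex_on UNIV (C t s)" for s
    using that f_convex
    by (auto intro: normal_integrand_one_step_cost[OF t f_borel] ext_convex_one_step_cost)
  ultimately show ?thesis
    by (intro exI[of _ "one_step_cost (C t) c f"]) (auto simp: one_step_cost_def f_def)
qed

end
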